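(* Let $(\tilde{\mathbf V}^\star,\mathbf p^\star,\mathbf g_{\mathcal V}^\star,\mathbf d_{\mathcal V}^\star,\boldsymbol\lambda_{\mathcal V}^\star,\boldsymbol\mu^\star,\boldsymbol\Lambda_{\mathcal E}^\star)$ be a primal and dual optimal solution of the second-order cone (SOC) relaxation, i.e., $(\tilde{\mathbf V}^\star,\mathbf p^\star,\mathbf g_{\mathcal V}^\star,\mathbf d_{\mathcal V}^\star)$ is optimal in the SOC relaxation and $(\boldsymbol\lambda_{\mathcal V}^\star,\boldsymbol\mu^\star,\boldsymbol\Lambda_{\mathcal E}^\star)$ is optimal in the dual of the SOC relaxation, and let $\tilde{\mathbf V}^\star$ permit a psd rank-1 completion. Then $(\mathbf v^\star,\mathbf p^\star,\mathbf g_{\mathcal V}^\star,\mathbf d_{\mathcal V}^\star,\boldsymbol\lambda_{\mathcal V}^\star,\boldsymbol\mu^\star)$, where $\mathbf v^\star(\mathbf v^\star)^H$ is a psd rank-1 completion of $\tilde{\mathbf V}^\star$, is a primal and dual optimal solution of the optimal power flow (OPF) problem, i.e., $(\mathbf v^\star,\mathbf p^\star,\mathbf g_{\mathcal V}^\star,\mathbf d_{\mathcal V}^\star)$ is optimal in the OPF problem and $(\boldsymbol\lambda_{\mathcal V}^\star,\boldsymbol\mu^\star)$ is optimal in the dual of the OPF problem.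
   Context: Notation: $\mathbb S^N$ is the set of Hermitian $N\times N$ matrices, $\mathbf X\succeq\mathbf 0$ means positive semidefinite (psd), $\mathbf e_n$ is a standard basis vector, $\mathbb R_+=[0,\infty)$; $\mathbf x_{\mathcal N}=(\mathbf x_n)_{n\in\mathcal N}$ denotes a tuple. Grid data. Buses $\mathcal V=\{1,\dots,N_V\}$, AC branches $\mathcal E=\{1,\dots,N_E\}$, DC branches $\mathcal D=\{1,\dots,N_D\}$; maps $\hat\epsilon,\check\epsilon:\mathcal E\to\mathcal V$ give source and destination of AC branches. There are no self-loops ($\hat\epsilon(k)\ne\check\epsilon(k)$), no two AC branches join the same pair of buses, and every bus is an endpoint of at least one AC branch. Let $\mathcal I=\{(i,j)\in\mathcal V\times\mathcal V: i,j\in\{\hat\epsilon(k),\check\epsilon(k)\}\text{ for some }k\in\mathcal E\}$. For each $n\in\mathcal V$ there are given: $\mathbf P_n,\mathbf Q_n\in\mathbb S^{N_V}$ (active/reactive power), $\mathbf h_n\in\mathbb R^{N_D}$, $\mathbf M_n=\mathbf e_n\mathbf e_n^{T}$, voltage bounds $0<\underline V_n\le\bar V_n$, nonempty compact convex sets $\mathcal G_n,\mathcal D_n\subset\mathbb R^2$ (generation, load), a convex cost $C_n:\mathcal G_n\to\mathbb R$ and a concave benefit $B_n:\mathcal D_n\to\mathbb R$. For each $k\in\mathcal E$ there are given matrices in $\mathbb S^{N_V}$: current matrices $\hat{\mathbf I}_k,\check{\mathbf I}_k$ with current bounds $\hat J_k,\check J_k\ge0$, voltage drop matrices $\underline{\mathbf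 M}_k,\bar{\mathbf M}_k$, and angle difference matrices $\mathbf A_k,\underline{\mathbf A}_k,\bar{\mathbf A}_k$. All these Hermitian matrices have zero entries outside $\mathcal I$. DC flow bounds are $\underline{\mathbf p},\bar{\mathbf p}\in\mathbb R^{N_D}$. Let $M=2N_V+7N_E+2N_D$, $\mathcal M=\{1,\dots,M\}$, and let $(\mathbf C_m,\mathbf c_m,b_m)\in\mathbb S^{N_V}\times\mathbb R^{N_D}\times\mathbb R$, $m\in\mathcal M$, enumerate: $(\mathbf M_n,\mathbf 0,\bar V_n^2)$ and $(-\mathbf M_n,\mathbf 0,-\underline V_n^2)$ for $n\in\mathcal V$; $(\hat{\mathbf I}_k,\mathbf 0,\hat J_k^2)$, $(\check{\mathbf I}_k,\mathbf 0,\check J_k^2)$ and $(\mathbf X,\mathbf 0,0)$ with $\mathbf X\in\{\underline{\mathbf M}_k,\bar{\mathbf M}_k,\mathbf A_k,\underline{\mathbf A}_k,\bar{\mathbf A}_k\}$ for $k\in\mathcal E$; $(\mathbf 0,\mathbf e_l,\bar p_l)$ and $(\mathbf 0,-\mathbf e_l,-\underline p_l)$ for $l\in\mathcal D$. Put $\mathbf b=[b_1,\dots,b_M]^T$. For $\mathbf W\in\mathbb S^{N_V}$, $\mathbf p\in\mathbb R^{N_D}$, $\mathbf g_n\in\mathcal G_n$, $\mathbf d_n\in\mathcal D_n$ ($n\in\mathcal V$), consider the constraints (PB) $\operatorname{tr}(\mathbf P_n\mathbf W)+\mathbf h_n^T\mathbf p=[\mathbf g_n-\mathbf d_n]_1$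 and $\operatorname{tr}(\mathbf Q_n\mathbf W)=[\mathbf g_n-\mathbf d_n]_2$ for all $n\in\mathcal V$; (IN) $\operatorname{tr}(\mathbf C_m\mathbf W)+\mathbf c_m^T\mathbf p\le b_m$ for all $m\in\mathcal M$. The objective (welfare) is $\sum_{n}B_n(\mathbf d_n)-\sum_n C_n(\mathbf g_n)$. OPF problem: maximize the welfare over $\mathbf v\in\mathbb C^{N_V}$, $\mathbf p$, $\mathbf g_n\in\mathcal G_n$, $\mathbf d_n\in\mathcal D_n$ subject to (PB), (IN) with $\mathbf W=\mathbf v\mathbf v^{H}$. Standing assumption (strict feasibility): there is an OPF-feasible tuple $(\mathbf v,\mathbf p,\mathbf g_{\mathcal V},\mathbf d_{\mathcal V})$ for which all inequalities in (IN) hold strictly and $\mathbf g_n-\mathbf d_n\in\operatorname{int}(\mathcal G_n-\mathcal D_n)$ for all $n$, where $\mathcal G_n-\mathcal D_n=\{\mathbf g-\mathbf d:\mathbf g\in\mathcal G_n,\mathbf d\in\mathcal D_n\}$; moreover all $\mathcal G_n,\mathcal D_n$ are polyhedral. Dual of the OPF problem: for $\boldsymbol\lambda_{\mathcal V}=(\boldsymbol\lambda_n)_{n\in\mathcal V}$, $\boldsymbol\lambda_n\in\mathbb R^2$, and $\boldsymbol\mu\in\mathbb R^M$ let $\Psi(\boldsymbol\lambda_{\mathcal V},\boldsymbol\mu)=\sum_n([\boldsymbol\lambda_n]_1\mathbf P_n+[\boldsymbol\lambda_n]_2\mathbf Q_n)+\sum_m[\boldsymbol\mu]_m\mathbf C_m$,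 $\psi(\boldsymbol\lambda_{\mathcal V},\boldsymbol\mu)=\sum_n[\boldsymbol\lambda_n]_1\mathbf h_n+\sum_m[\boldsymbol\mu]_m\mathbf c_m$, $\sigma_n(\boldsymbol\lambda_n)=\max_{\mathbf d\in\mathcal D_n}\{B_n(\mathbf d)-\boldsymbol\lambda_n^T\mathbf d\}$, $\pi_n(\boldsymbol\lambda_n)=\max_{\mathbf g\in\mathcal G_n}\{\boldsymbol\lambda_n^T\mathbf g-C_n(\mathbf g)\}$ (suprema if not attained). The dual is: minimize $\boldsymbol\mu^T\mathbf b+\sum_n\sigma_n(\boldsymbol\lambda_n)+\sum_n\pi_n(\boldsymbol\lambda_n)$ over $\boldsymbol\lambda_n\in\mathbb R^2$, $\boldsymbol\mu\in\mathbb R_+^M$ subject to $\Psi(\boldsymbol\lambda_{\mathcal V},\boldsymbol\mu)\succeq\mathbf 0$ and $\psi(\boldsymbol\lambda_{\mathcal V},\boldsymbol\mu)=\mathbf 0$. SOC relaxation: let $\tilde{\mathbb S}^{N_V}=\{\mathbf V\in\mathbb S^{N_V}:[\mathbf V]_{i,j}=0\ \forall (i,j)\notin\mathcal I\}$, $\mathbf S_k=[\mathbf e_{\hat\epsilon(k)},\mathbf e_{\check\epsilon(k)}]$, $\Xi_k(\tilde{\mathbf V})=\mathbf S_k^T\tilde{\mathbf V}\mathbf S_k\in\mathbb S^2$. Maximize the welfare over $\tilde{\mathbf V}\in\tilde{\mathbb S}^{N_V}$, $\mathbf p$, $\mathbf g_n\in\mathcal G_n$, $\mathbf d_n\in\mathcal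 D_n$ subject to (PB), (IN) with $\mathbf W=\tilde{\mathbf V}$ and $\Xi_k(\tilde{\mathbf V})\succeq\mathbf 0$ for all $k\in\mathcal E$. Dual of the SOC relaxation: minimize $\boldsymbol\mu^T\mathbf b+\sum_n\sigma_n(\boldsymbol\lambda_n)+\sum_n\pi_n(\boldsymbol\lambda_n)$ over $\boldsymbol\lambda_n\in\mathbb R^2$, $\boldsymbol\mu\in\mathbb R_+^M$, $\boldsymbol\Lambda_k\in\mathbb S^2$ ($k\in\mathcal E$) subject to $\Psi(\boldsymbol\lambda_{\mathcal V},\boldsymbol\mu)=\sum_{k}\mathbf S_k\boldsymbol\Lambda_k\mathbf S_k^T$, $\psi(\boldsymbol\lambda_{\mathcal V},\boldsymbol\mu)=\mathbf 0$, and $\boldsymbol\Lambda_k\succeq\mathbf 0$ for all $k\in\mathcal E$. A psd rank-1 completion of $\tilde{\mathbf V}\in\tilde{\mathbb S}^{N_V}$ is a psd rank-1 matrix $\mathbf V\in\mathbb S^{N_V}$ with $[\mathbf V]_{i,j}=[\tilde{\mathbf V}]_{i,j}$ for all $(i,j)\in\mathcal I$. *)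

theory Defs
  imports "HOL-Analysis.Analysis"
begin

section \<open>Hermitian and positive semidefinite matrices\<close>

type_synonym 'n cmat = "complex^'n^'n"

definition hermitian_mats :: "('n::finite) cmat set" where
  "hermitian_mats = {A. \<forall>i j. A $ i $ j = cnj (A $ j $ i)}"

text \<open>For a Hermitian \<open>A\<close> the form \<open>x\<^sup>H A x\<close> is real, so \<open>Re\<close> loses nothing here.\<close>
definition psd :: "('n::finite) cmat \<Rightarrow> bool" where
  "psd A \<longleftrightarrow> A \<in> hermitian_mats \<and>
     (\<forall>x :: complex^'n. 0 \<le> Re (\<Sum>i\<in>UNIV. cnj (x $ i) * (A *v x) $ i))"

definition outer :: "complex^'n \<Rightarrow> ('n::finite) cmat" where
  "outer v = (\<chi> i j. v $ i * cnj (v $ j))"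

text \<open>The trace of a product of two Hermitian matrices is real.\<close>
definition tr_prod :: "('n::finite) cmat \<Rightarrow> 'n cmat \<Rightarrow> real" where
  "tr_prod A W = Re (trace (A ** W))"


section \<open>Grid data\<close>

text \<open>
  Buses and AC branches are the elements of the finite types \<open>'v\<close> and \<open>'e\<close> (both are
  necessarily nonempty, since every bus is an endpoint of an AC branch).  There may be no
  DC branch at all, so the DC branches form a possibly empty subset \<open>dc\<close> of a finite type \<open>'d\<close>;
  accordingly, the space of real vectors indexed by DC branches is \<open>dc_space\<close> below.
\<close>
record ('v, 'e, 'd) grid =
  src     :: "'e \<Rightarrow> 'v"
  dst     :: "'e \<Rightarrow> 'v"
  dc      :: "'d set"
  Pmat    :: "'v \<Rightarrow> complex^'v^'v"
  Qmat    :: "'v \<Rightarrow> complex^'v^'v"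
  hvec    :: "'v \<Rightarrow> real^'d"
  Vmin    :: "'v \<Rightarrow> real"
  Vmax    :: "'v \<Rightarrow> real"
  Gen     :: "'v \<Rightarrow> (real^2) set"
  Load    :: "'v \<Rightarrow> (real^2) set"
  cost    :: "'v \<Rightarrow> real^2 \<Rightarrow> real"
  benefit :: "'v \<Rightarrow> real^2 \<Rightarrow> real"
  Isrc    :: "'e \<Rightarrow> complex^'v^'v"
  Idst    :: "'e \<Rightarrow> complex^'v^'v"
  Jsrc    :: "'e \<Rightarrow> real"
  Jdst    :: "'e \<Rightarrow> real"
  Mlo     :: "'e \<Rightarrow> complex^'v^'v"
  Mhi     :: "'e \<Rightarrow> complex^'v^'v"
  Amat    :: "'e \<Rightarrow> complex^'v^'v"
  Alo     :: "'e \<Rightarrow> complex^'v^'v"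
  Ahi     :: "'e \<Rightarrow> complex^'v^'v"
  pmin    :: "'d \<Rightarrow> real"
  pmax    :: "'d \<Rightarrow> real"

definition dc_space :: "('v::finite, 'e::finite, 'd::finite) grid \<Rightarrow> (real^'d) set" where
  "dc_space N = {p. \<forall>l. l \<notin> dc N \<longrightarrow> p $ l = 0}"

definition ends :: "('v::finite, 'e::finite, 'd::finite) grid \<Rightarrow> 'e \<Rightarrow> 'v set" where
  "ends N k = {src N k, dst N k}"

definition sparsity :: "('v::finite, 'e::finite, 'd::finite) grid \<Rightarrow> ('v \<times> 'v) set" where
  "sparsity N = {(i, j). \<exists>k. i \<in> ends N k \<and> j \<in> ends N k}"

definition sparse_hermitian_mats ::
    "('v::finite, 'e::finite, 'd::finite) grid \<Rightarrow> 'v cmat set" where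
  "sparse_hermitian_mats N =
     {V \<in> hermitian_mats. \<forall>i j. (i, j) \<notin> sparsity N \<longrightarrow> V $ i $ j = 0}"

definition grid_data :: "('v::finite, 'e::finite, 'd::finite) grid \<Rightarrow> bool" where
  "grid_data N \<longleftrightarrow>
     (\<forall>k. src N k \<noteq> dst N k) \<and>
     (\<forall>k k'. ends N k = ends N k' \<longrightarrow> k = k') \<and>
     (\<forall>n. \<exists>k. n \<in> ends N k) \<and>
     (\<forall>n. Pmat N n \<in> sparse_hermitian_mats N \<and> Qmat N n \<in> sparse_hermitian_mats N) \<and>
     (\<forall>n. hvec N n \<in> dc_space N) \<and>
     (\<forall>n. 0 < Vmin N n \<and> Vmin N n \<le> Vmax N n) \<and>
     (\<forall>n. Gen N n \<noteq> {} \<and> compact (Gen N n) \<and> convex (Gen N n)) \<and>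
     (\<forall>n. Load N n \<noteq> {} \<and> compact (Load N n) \<and> convex (Load N n)) \<and>
     (\<forall>n. convex_on (Gen N n) (cost N n)) \<and>
     (\<forall>n. concave_on (Load N n) (benefit N n)) \<and>
     (\<forall>k. Isrc N k \<in> sparse_hermitian_mats N \<and> Idst N k \<in> sparse_hermitian_mats N) \<and>
     (\<forall>k. 0 \<le> Jsrc N k \<and> 0 \<le> Jdst N k) \<and>
     (\<forall>k. Mlo N k \<in> sparse_hermitian_mats N \<and> Mhi N k \<in> sparse_hermitian_mats N) \<and>
     (\<forall>k. Amat N k \<in> sparse_hermitian_mats N \<and> Alo N k \<in> sparse_hermitian_mats N \<and>
          Ahi N k \<in> sparse_hermitian_mats N)"

text \<open>
  Instead of being numbered from \<open>1\<close> to \<open>M\<close>, the inequality constraints are indexed by the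
  constructors below; a vector in \<open>\<real>\<^sup>M\<close> is a function on the index set \<open>con_set\<close>.
\<close>
datatype ('v, 'e, 'd) con =
    V_upper 'v | V_lower 'v
  | I_src 'e | I_dst 'e
  | Drop_lo 'e | Drop_hi 'e
  | Angle 'e | Angle_lo 'e | Angle_hi 'e
  | P_upper 'd | P_lower 'd

definition con_set :: "('v::finite, 'e::finite, 'd::finite) grid \<Rightarrow> ('v, 'e, 'd) con set" where
  "con_set N =
     range V_upper \<union> range V_lower \<union> range I_src \<union> range I_dst \<union>
     range Drop_lo \<union> range Drop_hi \<union> range Angle \<union> range Angle_lo \<union> range Angle_hi \<union>
     P_upper ` dc N \<union> P_lower ` dc N"

definition Mmat :: "'v \<Rightarrow> ('v::finite) cmat" where
  "Mmat n = outer (axis n 1)"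

fun con_mat :: "('v::finite, 'e::finite, 'd::finite) grid \<Rightarrow> ('v, 'e, 'd) con \<Rightarrow> 'v cmat" where
  "con_mat N (V_upper n) = Mmat n"
| "con_mat N (V_lower n) = - Mmat n"
| "con_mat N (I_src k) = Isrc N k"
| "con_mat N (I_dst k) = Idst N k"
| "con_mat N (Drop_lo k) = Mlo N k"
| "con_mat N (Drop_hi k) = Mhi N k"
| "con_mat N (Angle k) = Amat N k"
| "con_mat N (Angle_lo k) = Alo N k"
| "con_mat N (Angle_hi k) = Ahi N k"
| "con_mat N (P_upper l) = 0"
| "con_mat N (P_lower l) = 0"

fun con_vec :: "('v::finite, 'e::finite, 'd::finite) grid \<Rightarrow> ('v, 'e, 'd) con \<Rightarrow> real^'d" where
  "con_vec N (P_upper l) = axis l 1"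
| "con_vec N (P_lower l) = - axis l 1"
| "con_vec N _ = 0"

fun con_bound :: "('v::finite, 'e::finite, 'd::finite) grid \<Rightarrow> ('v, 'e, 'd) con \<Rightarrow> real" where
  "con_bound N (V_upper n) = (Vmax N n)\<^sup>2"
| "con_bound N (V_lower n) = - (Vmin N n)\<^sup>2"
| "con_bound N (I_src k) = (Jsrc N k)\<^sup>2"
| "con_bound N (I_dst k) = (Jdst N k)\<^sup>2"
| "con_bound N (P_upper l) = pmax N l"
| "con_bound N (P_lower l) = - pmin N l"
| "con_bound N _ = 0"

lemma card_con_set:
  fixes N :: "('v::finite, 'e::finite, 'd::finite) grid"
  shows "finite (con_set N)"
    and "card (con_set N) = 2 * CARD('v) + 7 * CARD('e) + 2 * card (dc N)"
proof -
  show "finite (con_set N)"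
    by (simp add: con_set_def)
  show "card (con_set N) = 2 * CARD('v) + 7 * CARD('e) + 2 * card (dc N)"
    unfolding con_set_def
    by (subst card_Un_disjoint; (force | (auto simp: card_image inj_on_def)[1])?)+
qed


section \<open>Optimal power flow and its dual\<close>

definition power_balance :: "('v::finite, 'e::finite, 'd::finite) grid \<Rightarrow> 'v cmat \<Rightarrow> real^'d \<Rightarrow>
    ('v \<Rightarrow> real^2) \<Rightarrow> ('v \<Rightarrow> real^2) \<Rightarrow> bool" where
  "power_balance N W p g d \<longleftrightarrow>
     (\<forall>n. tr_prod (Pmat N n) W + hvec N n \<bullet> p = (g n - d n) $ 1 \<and>
          tr_prod (Qmat N n) W = (g n - d n) $ 2)"

definition con_value :: "('v::finite, 'e::finite, 'd::finite) grid \<Rightarrow> 'v cmat \<Rightarrow> real^'d \<Rightarrow>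
    ('v, 'e, 'd) con \<Rightarrow> real" where
  "con_value N W p m = tr_prod (con_mat N m) W + con_vec N m \<bullet> p"

definition flow_constraints :: "('v::finite, 'e::finite, 'd::finite) grid \<Rightarrow> 'v cmat \<Rightarrow> real^'d \<Rightarrow>
    ('v \<Rightarrow> real^2) \<Rightarrow> ('v \<Rightarrow> real^2) \<Rightarrow> bool" where
  "flow_constraints N W p g d \<longleftrightarrow>
     p \<in> dc_space N \<and> (\<forall>n. g n \<in> Gen N n) \<and> (\<forall>n. d n \<in> Load N n) \<and>
     power_balance N W p g d \<and> (\<forall>m\<in>con_set N. con_value N W p m \<le> con_bound N m)"

definition welfare :: "('v::finite, 'e::finite, 'd::finite) grid \<Rightarrow>
    ('v \<Rightarrow> real^2) \<Rightarrow> ('v \<Rightarrow> real^2) \<Rightarrow> real" where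
  "welfare N g d = (\<Sum>n\<in>UNIV. benefit N n (d n)) - (\<Sum>n\<in>UNIV. cost N n (g n))"

definition opf_feasible :: "('v::finite, 'e::finite, 'd::finite) grid \<Rightarrow> complex^'v \<Rightarrow> real^'d \<Rightarrow>
    ('v \<Rightarrow> real^2) \<Rightarrow> ('v \<Rightarrow> real^2) \<Rightarrow> bool" where
  "opf_feasible N v p g d \<longleftrightarrow> flow_constraints N (outer v) p g d"

definition opf_optimal :: "('v::finite, 'e::finite, 'd::finite) grid \<Rightarrow> complex^'v \<Rightarrow> real^'d \<Rightarrow>
    ('v \<Rightarrow> real^2) \<Rightarrow> ('v \<Rightarrow> real^2) \<Rightarrow> bool" where
  "opf_optimal N v p g d \<longleftrightarrow> opf_feasible N v p g d \<and>
     (\<forall>v' p' g' d'. opf_feasible N v' p' g' d' \<longrightarrow> welfare N g' d' \<le> welfare N g d)"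

definition strict_feasibility :: "('v::finite, 'e::finite, 'd::finite) grid \<Rightarrow> bool" where
  "strict_feasibility N \<longleftrightarrow>
     (\<exists>v p g d. opf_feasible N v p g d \<and>
        (\<forall>m\<in>con_set N. con_value N (outer v) p m < con_bound N m) \<and>
        (\<forall>n. g n - d n \<in> interior {x - y |x y. x \<in> Gen N n \<and> y \<in> Load N n})) \<and>
     (\<forall>n. polyhedron (Gen N n) \<and> polyhedron (Load N n))"

definition Psi :: "('v::finite, 'e::finite, 'd::finite) grid \<Rightarrow>
    ('v \<Rightarrow> real^2) \<Rightarrow> (('v, 'e, 'd) con \<Rightarrow> real) \<Rightarrow> 'v cmat" where
  "Psi N lam mu = (\<Sum>n\<in>UNIV. lam n $ 1 *\<^sub>R Pmat N n + lam n $ 2 *\<^sub>R Qmat N n) +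
     (\<Sum>m\<in>con_set N. mu m *\<^sub>R con_mat N m)"

definition psi :: "('v::finite, 'e::finite, 'd::finite) grid \<Rightarrow>
    ('v \<Rightarrow> real^2) \<Rightarrow> (('v, 'e, 'd) con \<Rightarrow> real) \<Rightarrow> real^'d" where
  "psi N lam mu = (\<Sum>n\<in>UNIV. lam n $ 1 *\<^sub>R hvec N n) + (\<Sum>m\<in>con_set N. mu m *\<^sub>R con_vec N m)"

text \<open>
  Under \<open>grid_data\<close> the suprema below are over nonempty sets that are bounded above (a concave
  function on a nonempty bounded convex set has an affine majorant), so they are the
  true suprema and not the unspecified value of \<open>Sup\<close> on an unbounded set of reals.
\<close>
definition load_surplus :: "('v::finite, 'e::finite, 'd::finite) grid \<Rightarrow> 'v \<Rightarrow> real^2 \<Rightarrow> real" where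
  "load_surplus N n l = (SUP d\<in>Load N n. benefit N n d - l \<bullet> d)"

definition gen_surplus :: "('v::finite, 'e::finite, 'd::finite) grid \<Rightarrow> 'v \<Rightarrow> real^2 \<Rightarrow> real" where
  "gen_surplus N n l = (SUP g\<in>Gen N n. l \<bullet> g - cost N n g)"

definition dual_objective :: "('v::finite, 'e::finite, 'd::finite) grid \<Rightarrow>
    ('v \<Rightarrow> real^2) \<Rightarrow> (('v, 'e, 'd) con \<Rightarrow> real) \<Rightarrow> real" where
  "dual_objective N lam mu = (\<Sum>m\<in>con_set N. mu m * con_bound N m) +
     (\<Sum>n\<in>UNIV. load_surplus N n (lam n)) + (\<Sum>n\<in>UNIV. gen_surplus N n (lam n))"

definition opf_dual_feasible :: "('v::finite, 'e::finite, 'd::finite) grid \<Rightarrow>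
    ('v \<Rightarrow> real^2) \<Rightarrow> (('v, 'e, 'd) con \<Rightarrow> real) \<Rightarrow> bool" where
  "opf_dual_feasible N lam mu \<longleftrightarrow>
     (\<forall>m\<in>con_set N. 0 \<le> mu m) \<and> psd (Psi N lam mu) \<and> psi N lam mu = 0"

definition opf_dual_optimal :: "('v::finite, 'e::finite, 'd::finite) grid \<Rightarrow>
    ('v \<Rightarrow> real^2) \<Rightarrow> (('v, 'e, 'd) con \<Rightarrow> real) \<Rightarrow> bool" where
  "opf_dual_optimal N lam mu \<longleftrightarrow> opf_dual_feasible N lam mu \<and>
     (\<forall>lam' mu'. opf_dual_feasible N lam' mu' \<longrightarrow>
        dual_objective N lam mu \<le> dual_objective N lam' mu')"


section \<open>Second-order cone relaxation and its dual\<close>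

definition Smat :: "('v::finite, 'e::finite, 'd::finite) grid \<Rightarrow> 'e \<Rightarrow> complex^2^'v" where
  "Smat N k = (\<chi> i j. if i = (if j = 1 then src N k else dst N k) then 1 else 0)"

definition Xi :: "('v::finite, 'e::finite, 'd::finite) grid \<Rightarrow> 'e \<Rightarrow> 'v cmat \<Rightarrow> 2 cmat" where
  "Xi N k V = transpose (Smat N k) ** V ** Smat N k"

definition soc_feasible :: "('v::finite, 'e::finite, 'd::finite) grid \<Rightarrow> 'v cmat \<Rightarrow> real^'d \<Rightarrow>
    ('v \<Rightarrow> real^2) \<Rightarrow> ('v \<Rightarrow> real^2) \<Rightarrow> bool" where
  "soc_feasible N V p g d \<longleftrightarrow> V \<in> sparse_hermitian_mats N \<and>
     flow_constraints N V p g d \<and> (\<forall>k. psd (Xi N k V))"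

definition soc_optimal :: "('v::finite, 'e::finite, 'd::finite) grid \<Rightarrow> 'v cmat \<Rightarrow> real^'d \<Rightarrow>
    ('v \<Rightarrow> real^2) \<Rightarrow> ('v \<Rightarrow> real^2) \<Rightarrow> bool" where
  "soc_optimal N V p g d \<longleftrightarrow> soc_feasible N V p g d \<and>
     (\<forall>V' p' g' d'. soc_feasible N V' p' g' d' \<longrightarrow> welfare N g' d' \<le> welfare N g d)"

definition soc_dual_feasible :: "('v::finite, 'e::finite, 'd::finite) grid \<Rightarrow>
    ('v \<Rightarrow> real^2) \<Rightarrow> (('v, 'e, 'd) con \<Rightarrow> real) \<Rightarrow> ('e \<Rightarrow> 2 cmat) \<Rightarrow> bool" where
  "soc_dual_feasible N lam mu Lam \<longleftrightarrow>
     (\<forall>m\<in>con_set N. 0 \<le> mu m) \<and>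
     Psi N lam mu = (\<Sum>k\<in>UNIV. Smat N k ** Lam k ** transpose (Smat N k)) \<and>
     psi N lam mu = 0 \<and> (\<forall>k. psd (Lam k))"

definition soc_dual_optimal :: "('v::finite, 'e::finite, 'd::finite) grid \<Rightarrow>
    ('v \<Rightarrow> real^2) \<Rightarrow> (('v, 'e, 'd) con \<Rightarrow> real) \<Rightarrow> ('e \<Rightarrow> 2 cmat) \<Rightarrow> bool" where
  "soc_dual_optimal N lam mu Lam \<longleftrightarrow> soc_dual_feasible N lam mu Lam \<and>
     (\<forall>lam' mu' Lam'. soc_dual_feasible N lam' mu' Lam' \<longrightarrow>
        dual_objective N lam mu \<le> dual_objective N lam' mu')"

definition psd_rank1_completion ::
    "('v::finite, 'e::finite, 'd::finite) grid \<Rightarrow> 'v cmat \<Rightarrow> 'v cmat \<Rightarrow> bool" where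
  "psd_rank1_completion N V' V \<longleftrightarrow>
     psd V' \<and> rank V' = 1 \<and> (\<forall>(i, j)\<in>sparsity N. V' $ i $ j = V $ i $ j)"

end

theory Submission
  imports Defs
begin

text \<open>
  Restricting \<open>v v\<^sup>H\<close> to the sparsity pattern turns every OPF-feasible point into a feasible point
  of the SOC relaxation with the same welfare, and the completion property reverses this at the
  given optimum, so \<open>v\<close> is optimal. On the dual side, \<open>\<Psi> = \<Sum>\<^sub>k S\<^sub>k \<Lambda>\<^sub>k S\<^sub>k\<^sup>T\<close> is psd, hence
  dual feasibility carries over. Since the SOC relaxation satisfies Slater's condition, its dual
  optimum equals its primal optimum, which is the welfare of the OPF-feasible point \<open>v\<close>; by weak
  duality for OPF no dual feasible point of OPF has a smaller objective.

  Everything is phrased with the real inner product of complex matrices: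
  \<open>tr(A W) = A \<bullet> W\<close> for Hermitian \<open>W\<close>, and \<open>x\<^sup>H A x\<close> has real part \<open>A \<bullet> x x\<^sup>H\<close>.
\<close>

section \<open>Lagrange multipliers and suprema over independent choices\<close>

text \<open>All sign conditions and identities for the multipliers come from this: a bound on the
  Lagrangian is tested along a ray in one variable.\<close>

lemma le_affine_imp_slope_le_0:
  fixes q :: real
  assumes "\<And>s. s \<ge> 0 \<Longrightarrow> c + s * q \<le> r"
  shows "q \<le> 0"
proof (rule ccontr)
  assume "\<not> q \<le> 0"
  define s where "s = (\<bar>r - c\<bar> + 1) / q"
  have "s \<ge> 0" and "s * q = \<bar>r - c\<bar> + 1"
    using \<open>\<not> q \<le> 0\<close> by (auto simp: s_def)
  with assms[of s] show False by linarith
qed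

text \<open>\<open>K\<close> plays the hypograph of the value function under perturbation, and the
  multiplier is the slope of a hyperplane supporting it above \<open>0\<close>. The condition
  \<open>slater\<close> puts points of the projection of \<open>K\<close> in every direction from
  \<open>0\<close>, which rules out a vertical hyperplane.\<close>

lemma lagrange_multiplier_exists:
  fixes K :: "('a::euclidean_space \<times> real) set"
  assumes "convex K"
    and opt: "\<And>t. (0, t) \<in> K \<Longrightarrow> t \<le> r"
    and slater: "\<And>z. \<exists>\<eta>>0. \<exists>t. (\<eta> *\<^sub>R z, t) \<in> K"
  obtains y where "\<And>z t. (z, t) \<in> K \<Longrightarrow> t + y \<bullet> z \<le> r"
proof -
  \<comment> \<open>The open ray above \<open>(0, r)\<close>; its disjointness from \<open>K\<close>
    is exactly the optimality bound \<open>opt\<close>.\<close>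
  define T :: "('a \<times> real) set" where "T = {0} \<times> {r<..}"
  have "convex T" "T \<noteq> {}" "K \<inter> T = {}"
    using opt by (force simp: T_def intro!: convex_Times)+
  moreover have "K \<noteq> {}"
    using slater by blast
  ultimately obtain a b where "a \<noteq> 0" and K: "\<forall>x\<in>K. a \<bullet> x \<le> b" and T: "\<forall>x\<in>T. b \<le> a \<bullet> x"
    using separating_hyperplane_sets[OF \<open>convex K\<close>] by blast
  obtain y \<tau> where a: "a = (y, \<tau>)" by (cases a)
  have K: "y \<bullet> z + \<tau> * t \<le> b" if "(z, t) \<in> K" for z t
    using K that a by force
  have T: "b \<le> \<tau> * s" if "s > r" for s
    using T that a by (force simp: T_def)
  \<comment> \<open>\<open>T\<close> is unbounded upwards, so the functional cannot decrease along
    it.\<close>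
  have "- \<tau> \<le> 0"
  proof (rule le_affine_imp_slope_le_0)
    fix s :: real assume "s \<ge> 0"
    then show "- \<tau> * (r + 1) + s * (- \<tau>) \<le> - b"
      using T[of "r + 1 + s"] by (simp add: algebra_simps)
  qed
  have b: "b \<le> \<tau> * r"
  proof (rule tendsto_lowerbound)
    show "((\<lambda>s. \<tau> * s) \<longlongrightarrow> \<tau> * r) (at_right r)"
      by (intro tendsto_intros)
    show "\<forall>\<^sub>F s in at_right r. b \<le> \<tau> * s"
      using T by (auto simp: eventually_at_right_field intro: exI[of _ "r + 1"])
  qed simp
  \<comment> \<open>If \<tau> were 0, then b \<le> 0, and a point of \<open>K\<close> in the
    direction \<open>y\<close> itself would force \<open>y = 0\<close>, against \<open>a\<close>
    being nonzero.\<close>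
  have "\<tau> \<noteq> 0"
  proof
    assume "\<tau> = 0"
    obtain \<eta> t where "\<eta> > 0" "(\<eta> *\<^sub>R y, t) \<in> K"
      using slater by blast
    with K[of "\<eta> *\<^sub>R y" t] b \<open>\<tau> = 0\<close> have "\<eta> * (y \<bullet> y) \<le> 0" by simp
    with \<open>\<eta> > 0\<close> have "y = 0"
      by (metis inner_gt_zero_iff mult_pos_pos not_less)
    with \<open>\<tau> = 0\<close> \<open>a \<noteq> 0\<close> a show False by (simp add: zero_prod_def)
  qed
  with \<open>- \<tau> \<le> 0\<close> have "\<tau> > 0" by simp
  show thesis
  proof
    fix z t assume "(z, t) \<in> K"
    from K[OF this] b have "\<tau> * t + y \<bullet> z \<le> \<tau> * r" by simp
    with \<open>\<tau> > 0\<close> show "t + (y /\<^sub>R \<tau>) \<bullet> z \<le> r"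
      by (simp add: field_simps)
  qed
qed

text \<open>The choices are independent, so the suprema can be taken one index at a time: with
  \<open>f j y\<close> moved into the bound, the induction hypothesis handles the rest, and only
  then does \<open>y\<close> vary.\<close>

lemma sum_SUP_le:
  fixes f :: "'i \<Rightarrow> 'a \<Rightarrow> real"
  assumes "finite I" and "\<And>i. S i \<noteq> {}"
    and le: "\<And>x. (\<And>i. x i \<in> S i) \<Longrightarrow> (\<Sum>i\<in>I. f i (x i)) \<le> c"
  shows "(\<Sum>i\<in>I. SUP x\<in>S i. f i x) \<le> c"
  using \<open>finite I\<close> le
proof (induction I arbitrary: c)
  case empty
  \<comment> \<open>For the empty sum the hypothesis yields \<open>0 \<le> c\<close> only once some
    selection \<open>x\<close> is exhibited.\<close>
  have "(SOME y. y \<in> S i) \<in> S i" for i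
    using assms(2) by (simp add: some_in_eq)
  from empty[OF this] show ?case by simp
next
  case (insert j I)
  have "(\<Sum>i\<in>I. SUP x\<in>S i. f i x) \<le> c - f j y" if y: "y \<in> S j" for y
  proof (rule insert.IH)
    fix x assume x: "\<And>i. x i \<in> S i"
    have "(\<Sum>i\<in>insert j I. f i ((x(j := y)) i)) \<le> c"
      using x y by (intro insert.prems) auto
    moreover have "(\<Sum>i\<in>I. f i ((x(j := y)) i)) = (\<Sum>i\<in>I. f i (x i))"
      using insert.hyps by (intro sum.cong) auto
    ultimately show "(\<Sum>i\<in>I. f i (x i)) \<le> c - f j y"
      using insert.hyps by simp
  qed
  then have "(SUP y\<in>S j. f j y) \<le> c - (\<Sum>i\<in>I. SUP x\<in>S i. f i x)"
    using assms(2) by (intro cSUP_least) force+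
  then show ?case
    using insert.hyps by simp
qed

text \<open>Freeze all choices except the one at \<open>j\<close>. This certifies that the suprema
  in the dual objective are genuine at the constructed multiplier.\<close>

lemma bdd_above_of_sum_le:
  fixes f :: "'i \<Rightarrow> 'a \<Rightarrow> real"
  assumes "finite I" "j \<in> I" and "\<And>i. S i \<noteq> {}"
    and le: "\<And>x. (\<And>i. x i \<in> S i) \<Longrightarrow> (\<Sum>i\<in>I. f i (x i)) \<le> c"
  shows "bdd_above (f j ` S j)"
proof -
  define x where "x i = (SOME y. y \<in> S i)" for i
  have x: "x i \<in> S i" for i
    using assms(3) by (simp add: x_def some_in_eq)
  have "f j y \<le> c - (\<Sum>i\<in>I - {j}. f i (x i))" if "y \<in> S j" for y
  proof -
    have "(\<Sum>i\<in>I. f i ((x(j := y)) i)) \<le> c"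
      using x that by (intro le) auto
    moreover have "(\<Sum>i\<in>I - {j}. f i ((x(j := y)) i)) = (\<Sum>i\<in>I - {j}. f i (x i))"
      by (intro sum.cong) auto
    ultimately show ?thesis
      using assms(1,2) by (simp add: sum.remove)
  qed
  then show ?thesis by (meson bdd_aboveI2)
qed

section \<open>Hermitian matrices in the real inner product\<close>

lemma inner_cmat:
  fixes A B :: "complex^'n::finite^'m::finite"
  shows "A \<bullet> B = (\<Sum>i\<in>UNIV. \<Sum>j\<in>UNIV. Re (A $ i $ j * cnj (B $ i $ j)))"
  by (simp add: inner_vec_def inner_complex_def)

lemma hermitian_mats_iff: "A \<in> hermitian_mats \<longleftrightarrow> (\<forall>i j. cnj (A $ i $ j) = A $ j $ i)"
  unfolding hermitian_mats_def mem_Collect_eq by (rule iffI; intro allI; drule spec; drule spec; erule sym)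

lemma hermitian_mats_D: "A \<in> hermitian_mats \<Longrightarrow> cnj (A $ i $ j) = A $ j $ i"
  by (simp add: hermitian_mats_iff)

lemma subspace_hermitian_mats: "subspace hermitian_mats"
  by (simp add: hermitian_mats_iff subspace_def)

lemma subspace_sparse_hermitian_mats: "subspace (sparse_hermitian_mats N)"
  using subspace_hermitian_mats
  by (auto simp: sparse_hermitian_mats_def subspace_def)

lemma subspace_dc_space: "subspace (dc_space N)"
  by (simp add: dc_space_def subspace_def)

lemma tr_prod_eq_inner:
  assumes "W \<in> hermitian_mats"
  shows "tr_prod A W = A \<bullet> W"
  using assms by (simp add: tr_prod_def trace_def matrix_matrix_mult_def inner_cmat hermitian_mats_D)

lemma outer_hermitian: "outer v \<in> hermitian_mats"
  by (simp add: outer_def hermitian_mats_iff mult.commute)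

lemma inner_outer:
  "A \<bullet> outer x = Re (\<Sum>i\<in>UNIV. cnj (x $ i) * (A *v x) $ i)"
  by (simp add: inner_cmat outer_def matrix_vector_mult_def sum_distrib_left mult_ac)

lemma psd_iff: "psd A \<longleftrightarrow> A \<in> hermitian_mats \<and> (\<forall>x. 0 \<le> A \<bullet> outer x)"
  by (simp only: psd_def inner_outer)

text \<open>The double sum factors into x^H v times its conjugate.\<close>

lemma inner_outer_outer: "outer v \<bullet> outer x = (cmod (\<Sum>i\<in>UNIV. cnj (x $ i) * v $ i))\<^sup>2"
proof -
  let ?s = "\<Sum>i\<in>UNIV. cnj (x $ i) * v $ i"
  have "?s * cnj ?s = (\<Sum>i\<in>UNIV. \<Sum>j\<in>UNIV. outer v $ i $ j * cnj (outer x $ i $ j))"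
    by (simp add: outer_def sum_product mult_ac)
  moreover have "outer v \<bullet> outer x = Re (\<Sum>i\<in>UNIV. \<Sum>j\<in>UNIV. outer v $ i $ j * cnj (outer x $ i $ j))"
    by (simp only: inner_cmat Re_sum)
  ultimately have "outer v \<bullet> outer x = Re (?s * cnj ?s)"
    by simp
  also have "\<dots> = (cmod ?s)\<^sup>2"
    by (simp only: complex_mult_cnj cmod_power2 Re_complex_of_real)
  finally show ?thesis .
qed

lemma psd_outer: "psd (outer v)"
  by (simp add: psd_iff outer_hermitian inner_outer_outer)

text \<open>With \<open>inner_mat_1_outer\<close>, this lets a multiple of the identity dominate the
  quadratic form of any matrix of bounded norm.\<close>

lemma norm_outer: "norm (outer x) = (norm x)\<^sup>2"
proof -
  have "(\<Sum>i\<in>UNIV. cnj (x $ i) * x $ i) = of_real ((norm x)\<^sup>2)"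
    by (simp add: norm_vec_def L2_set_def sum_nonneg mult.commute flip: complex_norm_square)
  then have "outer x \<bullet> outer x = ((norm x)\<^sup>2)\<^sup>2"
    unfolding inner_outer_outer by (simp add: norm_power)
  then show ?thesis
    by (simp add: norm_eq_sqrt_inner)
qed

lemma inner_mat_1_outer: "mat 1 \<bullet> outer x = (norm x)\<^sup>2"
  by (simp add: inner_outer norm_vec_def L2_set_def sum_nonneg complex_mult_cnj cmod_power2 mult.commute)

text \<open>Test with Z = A - A^H, whose quadratic form has real part zero. As A and A^H have equal
  norm, the squared norm of Z is twice the inner product of A and Z, so it vanishes.\<close>

lemma hermitian_of_orthogonal:
  assumes "\<And>Z. (\<And>x. Z \<bullet> outer x = 0) \<Longrightarrow> A \<bullet> Z \<le> 0"
  shows "A \<in> hermitian_mats"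
proof -
  define B where "B = (\<chi> i j. cnj (A $ j $ i))"
  have "B \<bullet> outer x = A \<bullet> outer x" for x
    unfolding inner_cmat B_def outer_def
    by (subst sum.swap) (intro sum.cong; simp add: algebra_simps)
  then have le: "A \<bullet> (A - B) \<le> 0"
    by (intro assms) (simp add: inner_diff_left)
  have "B \<bullet> B = A \<bullet> A"
    unfolding inner_cmat B_def by (subst sum.swap) (intro sum.cong; simp)
  then have "(A - B) \<bullet> (A - B) = 2 * (A \<bullet> (A - B))"
    by (simp add: algebra_simps inner_commute)
  with le have "A = B"
    by (metis diff_eq_diff_eq diff_self inner_gt_zero_iff mult_le_0_iff not_less zero_le_numeral)
  then have "B $ j $ i = A $ j $ i" for i j
    by (simp only:)
  then show ?thesis
    by (simp add: hermitian_mats_iff B_def)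
qed

text \<open>A one-dimensional row space gives entries u_i w_j. A column through a nonzero diagonal
  entry, suitably scaled, is then the required vector.\<close>

lemma psd_rank_1_eq_outer:
  fixes A :: "complex^'n::finite^'n"
  assumes "psd A" and "rank A = 1"
  obtains v where "A = outer v"
proof -
  obtain B where "rows A \<subseteq> vec.span B" "card B = 1"
    using vec.basis_exists[of "rows A"] assms(2) by (metis row_rank_def_gen)
  then obtain w where "rows A \<subseteq> vec.span {w}"
    by (metis card_1_singletonE)
  then have "\<exists>c. row i A = c *s w" for i
    by (force simp: rows_def vec.span_singleton)
  then obtain u where "\<And>i. row i A = u i *s w"
    by metis
  then have A: "A $ i $ j = u i * w $ j" for i j
    by (metis row_def vec_lambda_beta vec_nth_inverse vector_smult_component)
  have herm: "cnj (A $ i $ j) = A $ j $ i" for i j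
    using assms(1) by (simp add: psd_iff hermitian_mats_D)
  have "A \<noteq> 0"
  proof
    assume "A = 0"
    then have "rank A = 0"
      by (auto simp: row_rank_def_gen rows_def row_def vec_eq_iff)
    with assms(2) show False
      by simp
  qed
  then obtain i j where "A $ i $ j \<noteq> 0"
    by (auto simp: vec_eq_iff)
  \<comment> \<open>By symmetry u_j w_i is nonzero along with u_i w_j, hence so is u_i w_i.\<close>
  then have nz: "A $ i $ i \<noteq> 0"
    using herm[of i j] by (auto simp: A)
  have "0 \<le> A \<bullet> outer (axis i 1)"
    using assms(1) by (simp add: psd_iff)
  also have "A \<bullet> outer (axis i 1) = Re (A $ i $ i)"
  proof -
    have "cnj (axis i 1 $ a) * (A *v axis i 1) $ a = (if a = i then A $ i $ i else 0)" for a
      by (simp add: matrix_vector_mult_def axis_def if_distrib cong: if_cong)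
    then show ?thesis
      by (simp add: inner_outer)
  qed
  finally obtain r where r: "A $ i $ i = of_real r" "r > 0"
    using nz herm[of i i] by (metis Reals_cnj_iff Reals_cases Re_complex_of_real less_eq_real_def of_real_0)
  \<comment> \<open>Scaled so that v_a cnj(v_b) = A_ai A_ib / A_ii, which the product form of the
    entries collapses to A_ab.\<close>
  define v where "v = (\<chi> a. A $ a $ i / sqrt r)"
  have "A $ a $ b = v $ a * cnj (v $ b)" for a b
  proof -
    have "complex_of_real (sqrt r) * complex_of_real (sqrt r) = of_real r"
      using r by (simp flip: of_real_mult)
    then have "v $ a * cnj (v $ b) = A $ a $ i * A $ i $ b / A $ i $ i"
      using r by (simp add: v_def herm)
    also have "\<dots> = A $ a $ b"
      using nz by (simp add: A)
    finally show ?thesis by simp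
  qed
  then show thesis
    by (intro that[of v]) (simp add: vec_eq_iff outer_def)
qed

text \<open>Makes \<open>real^con\<close> a Euclidean space, so that perturbations of (IN) can be
  separated by a hyperplane.\<close>

instance con :: (finite, finite, finite) finite
proof
  have eq: "(UNIV :: ('a, 'b, 'c) con set) =
     range V_upper \<union> range V_lower \<union> range I_src \<union> range I_dst \<union>
     range Drop_lo \<union> range Drop_hi \<union> range Angle \<union> range Angle_lo \<union> range Angle_hi \<union>
     range P_upper \<union> range P_lower" (is "_ = ?R")
  proof (intro set_eqI iffI)
    fix m :: "('a, 'b, 'c) con"
    show "m \<in> ?R" by (cases m) auto
  qed simp
  show "finite (UNIV :: ('a, 'b, 'c) con set)"
    unfolding eq by simp
qed


section \<open>Sparsity pattern and branch submatrices\<close>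

definition endpt :: "('v::finite, 'e::finite, 'd::finite) grid \<Rightarrow> 'e \<Rightarrow> 2 \<Rightarrow> 'v" where
  "endpt N k a = (if a = 1 then src N k else dst N k)"

text \<open>The adjoint of \<open>Xi N k\<close> for the real inner product, as
  \<open>inner_lift_mat\<close> confirms.\<close>

definition lift_mat ::
    "('v::finite, 'e::finite, 'd::finite) grid \<Rightarrow> 'e \<Rightarrow> 2 cmat \<Rightarrow> 'v cmat" where
  "lift_mat N k L = Smat N k ** L ** transpose (Smat N k)"

definition sparse_part ::
    "('v::finite, 'e::finite, 'd::finite) grid \<Rightarrow> 'v cmat \<Rightarrow> 'v cmat" where
  "sparse_part N W = (\<chi> i j. if (i, j) \<in> sparsity N then W $ i $ j else 0)"

lemma Smat_nth: "Smat N k $ i $ a = (if i = endpt N k a then 1 else 0)"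
  by (simp add: Smat_def endpt_def)

lemma endpt_in_sparsity: "(endpt N k a, endpt N k b) \<in> sparsity N"
  by (auto simp: endpt_def sparsity_def ends_def)

lemma Xi_nth: "Xi N k V $ a $ b = V $ endpt N k a $ endpt N k b"
  by (simp add: Xi_def matrix_matrix_mult_def transpose_def Smat_nth if_distrib[of "\<lambda>x. x * _"]
      if_distrib[of "\<lambda>x. _ * x"] cong: if_cong)

lemma linear_Xi: "linear (Xi N k)"
  by (rule linearI) (simp_all add: vec_eq_iff Xi_nth)

lemma lift_mat_nth:
  "lift_mat N k L $ i $ j =
     (\<Sum>a\<in>UNIV. \<Sum>b\<in>UNIV. if i = endpt N k a then if j = endpt N k b then L $ a $ b else 0 else 0)"
  unfolding lift_mat_def matrix_matrix_mult_def transpose_def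
  by (simp add: Smat_nth sum_2)

lemma inner_lift_mat: "lift_mat N k L \<bullet> V = L \<bullet> Xi N k V"
proof -
  have delta: "(\<Sum>i\<in>UNIV. \<Sum>j\<in>UNIV. Re ((if i = s then if j = t then c else 0 else 0) * cnj (V $ i $ j)))
      = Re (c * cnj (V $ s $ t))" for s t c
  proof -
    have "(\<Sum>j\<in>UNIV. Re ((if i = s then if j = t then c else 0 else 0) * cnj (V $ i $ j))) =
        (if i = s then Re (c * cnj (V $ s $ t)) else 0)" for i
      by (simp add: if_distrib[of "\<lambda>x. x * _"] if_distrib[of Re] cong: if_cong)
    then show ?thesis by simp
  qed
  show ?thesis
    unfolding inner_cmat[of "lift_mat N k L"] lift_mat_nth sum_2 distrib_right plus_complex.sel
      sum.distrib delta
    by (simp add: inner_cmat sum_2 Xi_nth)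
qed

lemma lift_mat_sparse_hermitian:
  assumes "L \<in> hermitian_mats"
  shows "lift_mat N k L \<in> sparse_hermitian_mats N"
  unfolding sparse_hermitian_mats_def hermitian_mats_iff mem_Collect_eq
proof (intro conjI allI impI)
  show "cnj (lift_mat N k L $ i $ j) = lift_mat N k L $ j $ i" for i j
    by (simp add: lift_mat_nth sum_2 hermitian_mats_D[OF assms])
  show "lift_mat N k L $ i $ j = 0" if "(i, j) \<notin> sparsity N" for i j
    unfolding lift_mat_nth
    using that endpt_in_sparsity[of N k] by (intro sum.neutral ballI) auto
qed

lemma Xi_outer: "Xi N k (outer v) = outer (\<chi> a. v $ endpt N k a)"
  by (simp add: vec_eq_iff Xi_nth outer_def)

text \<open>Distinct endpoints make the block the identity; for a self-loop it would be the singular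
  all-ones matrix. This is what makes an identity shift positive definite on every branch.\<close>

lemma Xi_mat_1:
  assumes "src N k \<noteq> dst N k"
  shows "Xi N k (mat 1) = mat 1"
  using assms by (auto simp: vec_eq_iff Xi_nth mat_def endpt_def forall_2)

lemma Xi_cong_sparsity:
  assumes "\<And>i j. (i, j) \<in> sparsity N \<Longrightarrow> W $ i $ j = V $ i $ j"
  shows "Xi N k W = Xi N k V"
  by (simp add: vec_eq_iff Xi_nth assms endpt_in_sparsity)

lemma inner_cong_sparsity:
  assumes "A \<in> sparse_hermitian_mats N"
    and "\<And>i j. (i, j) \<in> sparsity N \<Longrightarrow> W $ i $ j = V $ i $ j"
  shows "A \<bullet> W = A \<bullet> V"
  unfolding inner_cmat
proof (intro sum.cong refl)
  fix i j
  show "Re (A $ i $ j * cnj (W $ i $ j)) = Re (A $ i $ j * cnj (V $ i $ j))"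
    using assms by (cases "(i, j) \<in> sparsity N") (auto simp: sparse_hermitian_mats_def)
qed

lemma sparse_part_nth: "(i, j) \<in> sparsity N \<Longrightarrow> sparse_part N W $ i $ j = W $ i $ j"
  by (simp add: sparse_part_def)

lemma sparse_part_sparse_hermitian:
  assumes "W \<in> hermitian_mats"
  shows "sparse_part N W \<in> sparse_hermitian_mats N"
proof -
  have "(j, i) \<in> sparsity N \<longleftrightarrow> (i, j) \<in> sparsity N" for i j
    by (auto simp: sparsity_def)
  with assms show ?thesis
    by (auto simp: sparse_hermitian_mats_def hermitian_mats_iff sparse_part_def)
qed

lemma sparse_hermitian_subset: "A \<in> sparse_hermitian_mats N \<Longrightarrow> A \<in> hermitian_mats"
  by (simp add: sparse_hermitian_mats_def)

text \<open>Every bus is an endpoint of a branch; hence the identity and the voltage matrices fit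
  the pattern.\<close>

lemma diagonal_in_sparsity: "grid_data N \<Longrightarrow> (n, n) \<in> sparsity N"
  by (auto simp: grid_data_def sparsity_def)

lemma mat_1_sparse_hermitian: "grid_data N \<Longrightarrow> mat 1 \<in> sparse_hermitian_mats N"
  by (auto simp: sparse_hermitian_mats_def hermitian_mats_iff mat_def dest: diagonal_in_sparsity)

lemma Mmat_sparse_hermitian: "grid_data N \<Longrightarrow> Mmat n \<in> sparse_hermitian_mats N"
  by (auto simp: Mmat_def sparse_hermitian_mats_def outer_hermitian)
     (auto simp: outer_def axis_def dest: diagonal_in_sparsity)

lemma con_mat_sparse_hermitian:
  assumes "grid_data N"
  shows "con_mat N m \<in> sparse_hermitian_mats N"
  using assms Mmat_sparse_hermitian[OF assms] subspace_sparse_hermitian_mats[of N]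
  by (cases m) (auto simp: grid_data_def subspace_neg subspace_0)

lemma con_vec_in_dc_space: "m \<in> con_set N \<Longrightarrow> con_vec N m \<in> dc_space N"
  by (auto simp: con_set_def dc_space_def axis_def)

lemma Psi_sparse_hermitian:
  assumes "grid_data N"
  shows "Psi N lam mu \<in> sparse_hermitian_mats N"
  unfolding Psi_def
  using assms con_mat_sparse_hermitian[OF assms]
  by (intro subspace_add subspace_sum subspace_scale subspace_sparse_hermitian_mats)
     (auto simp: grid_data_def)

lemma psi_in_dc_space:
  assumes "grid_data N"
  shows "psi N lam mu \<in> dc_space N"
  unfolding psi_def
  using assms
  by (intro subspace_add subspace_sum subspace_scale subspace_dc_space con_vec_in_dc_space)
     (auto simp: grid_data_def)


section \<open>The constraints as linear maps\<close>

text \<open>Both left sides of (PB) at a bus as one vector, with the trace replaced by the inner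
  product; the two agree for Hermitian \<open>W\<close>.\<close>

definition bus_power ::
    "('v::finite, 'e::finite, 'd::finite) grid \<Rightarrow> 'v \<Rightarrow> 'v cmat \<Rightarrow> real^'d \<Rightarrow> real^2" where
  "bus_power N n W p = (\<chi> i. if i = 1 then Pmat N n \<bullet> W + hvec N n \<bullet> p else Qmat N n \<bullet> W)"

lemma bus_power_add: "bus_power N n (W + W') (p + p') = bus_power N n W p + bus_power N n W' p'"
  by (simp add: vec_eq_iff bus_power_def inner_add_right)

lemma bus_power_scaleR: "bus_power N n (c *\<^sub>R W) (c *\<^sub>R p) = c *\<^sub>R bus_power N n W p"
  by (simp add: vec_eq_iff bus_power_def distrib_left)

lemma flow_constraints_iff:
  assumes "W \<in> hermitian_mats"
  shows "flow_constraints N W p g d \<longleftrightarrow>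
     p \<in> dc_space N \<and> (\<forall>n. g n \<in> Gen N n) \<and> (\<forall>n. d n \<in> Load N n) \<and>
     (\<forall>n. bus_power N n W p = g n - d n) \<and>
     (\<forall>m\<in>con_set N. con_mat N m \<bullet> W + con_vec N m \<bullet> p \<le> con_bound N m)"
  using assms
  by (simp add: flow_constraints_def power_balance_def con_value_def tr_prod_eq_inner
      bus_power_def vec_eq_iff forall_2)

text \<open>All data matrices vanish off the pattern, so the constraints cannot tell a matrix from
  its completion.\<close>

lemma flow_constraints_cong_sparsity:
  assumes "grid_data N" "W \<in> hermitian_mats" "V \<in> hermitian_mats"
    and eq: "\<And>i j. (i, j) \<in> sparsity N \<Longrightarrow> W $ i $ j = V $ i $ j"
  shows "flow_constraints N W p g d \<longleftrightarrow> flow_constraints N V p g d"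
proof -
  have "A \<bullet> W = A \<bullet> V" if "A \<in> sparse_hermitian_mats N" for A
    using inner_cong_sparsity[OF that eq] .
  with assms(1) con_mat_sparse_hermitian[OF assms(1)]
  have "Pmat N n \<bullet> W = Pmat N n \<bullet> V" "Qmat N n \<bullet> W = Qmat N n \<bullet> V"
    "con_mat N m \<bullet> W = con_mat N m \<bullet> V" for n m
    by (auto simp: grid_data_def)
  then show ?thesis
    by (simp add: flow_constraints_iff assms bus_power_def cong: if_cong)
qed

lemma inner_real2: "x \<bullet> y = x $ 1 * y $ 1 + x $ 2 * y $ 2" for x y :: "real^2"
  by (simp add: inner_vec_def sum_2)

text \<open>The origin of \<open>Psi\<close> and \<open>psi\<close>: they are the coefficients of
  \<open>W\<close> and \<open>p\<close> in the Lagrangian.\<close>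

lemma lagrangian_linear_part:
  "(\<Sum>n\<in>UNIV. lam n \<bullet> bus_power N n W p) +
   (\<Sum>m\<in>con_set N. mu m * (con_mat N m \<bullet> W + con_vec N m \<bullet> p)) = Psi N lam mu \<bullet> W + psi N lam mu \<bullet> p"
  by (simp add: Psi_def psi_def bus_power_def inner_real2 inner_add_left
      inner_sum_left sum.distrib algebra_simps)

section \<open>Passing between OPF and the relaxation, primal and dual\<close>

text \<open>Truncation to the pattern leaves each branch block intact, and that block is the outer
  product of \<open>v\<close> restricted to the two endpoints, hence psd.\<close>

lemma soc_feasible_of_opf_feasible:
  assumes "grid_data N" and "opf_feasible N v p g d"
  shows "soc_feasible N (sparse_part N (outer v)) p g d"
proof -
  let ?V = "sparse_part N (outer v)"
  have V: "?V \<in> sparse_hermitian_mats N"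
    by (simp add: sparse_part_sparse_hermitian outer_hermitian)
  have "flow_constraints N ?V p g d"
    using assms(2) flow_constraints_cong_sparsity[OF assms(1), of ?V "outer v"]
      sparse_hermitian_subset[OF V]
    by (simp add: opf_feasible_def outer_hermitian sparse_part_nth)
  moreover have "Xi N k ?V = Xi N k (outer v)" for k
    by (rule Xi_cong_sparsity) (rule sparse_part_nth)
  ultimately show ?thesis
    using V by (simp add: soc_feasible_def Xi_outer psd_outer)
qed

text \<open>By adjointness the quadratic form at \<open>x\<close> is the sum of the forms of
  \<open>Lam k\<close> at the restrictions of \<open>x\<close> to the branches.\<close>

lemma psd_sum_lift_mat:
  assumes "\<And>k. psd (Lam k)"
  shows "psd (\<Sum>k\<in>UNIV. lift_mat N k (Lam k))"
  unfolding psd_iff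
proof (intro conjI allI)
  show "(\<Sum>k\<in>UNIV. lift_mat N k (Lam k)) \<in> hermitian_mats"
    using assms
    by (intro subspace_sum subspace_hermitian_mats sparse_hermitian_subset[OF lift_mat_sparse_hermitian])
       (simp add: psd_iff)
  fix x
  show "0 \<le> (\<Sum>k\<in>UNIV. lift_mat N k (Lam k)) \<bullet> outer x"
    using assms by (simp add: inner_sum_left inner_lift_mat Xi_outer psd_iff sum_nonneg)
qed

section \<open>Strong duality for the second-order cone relaxation\<close>

text \<open>
  The bound on the matrix component only involves the quadratic form, so that this component
  ranges over all matrices and the set has nonempty interior.
\<close>
definition attainable :: "('v::finite, 'e::finite, 'd::finite) grid \<Rightarrow>
    ((((real^2)^'v) \<times> (real^(('v, 'e, 'd) con)) \<times> ((2 cmat)^'e)) \<times> real) set" where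
  "attainable N = {((a, b, c), t). \<exists>V p g d.
     V \<in> sparse_hermitian_mats N \<and> p \<in> dc_space N \<and> (\<forall>n. g n \<in> Gen N n) \<and> (\<forall>n. d n \<in> Load N n) \<and>
     (\<forall>n. a $ n = bus_power N n V p - (g n - d n)) \<and>
     (\<forall>m\<in>con_set N. con_mat N m \<bullet> V + con_vec N m \<bullet> p - con_bound N m \<le> b $ m) \<and>
     (\<forall>k x. c $ k \<bullet> outer x \<le> Xi N k V \<bullet> outer x) \<and>
     t \<le> welfare N g d}"

lemma attainableI:
  assumes "V \<in> sparse_hermitian_mats N" "p \<in> dc_space N" "\<And>n. g n \<in> Gen N n" "\<And>n. d n \<in> Load N n"
    and "\<And>n. a $ n = bus_power N n V p - (g n - d n)"
    and "\<And>m. m \<in> con_set N \<Longrightarrow> con_mat N m \<bullet> V + con_vec N m \<bullet> p - con_bound N m \<le> b $ m"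
    and "\<And>k x. c $ k \<bullet> outer x \<le> Xi N k V \<bullet> outer x"
    and "t \<le> welfare N g d"
  shows "((a, b, c), t) \<in> attainable N"
  unfolding attainable_def using assms by blast

lemma welfare_mixture:
  assumes "grid_data N" and "\<And>n. g n \<in> Gen N n" "\<And>n. g' n \<in> Gen N n"
    "\<And>n. d n \<in> Load N n" "\<And>n. d' n \<in> Load N n" and "u \<ge> 0" "v \<ge> 0" "u + v = 1"
  shows "u * welfare N g d + v * welfare N g' d' \<le>
     welfare N (\<lambda>n. u *\<^sub>R g n + v *\<^sub>R g' n) (\<lambda>n. u *\<^sub>R d n + v *\<^sub>R d' n)"
proof -
  have "u * benefit N n (d n) + v * benefit N n (d' n) \<le> benefit N n (u *\<^sub>R d n + v *\<^sub>R d' n)"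
    and "cost N n (u *\<^sub>R g n + v *\<^sub>R g' n) \<le> u * cost N n (g n) + v * cost N n (g' n)" for n
    using assms by (auto simp: grid_data_def concave_on_iff convex_on_def)
  then have "(\<Sum>n\<in>UNIV. u * benefit N n (d n) + v * benefit N n (d' n)) \<le>
      (\<Sum>n\<in>UNIV. benefit N n (u *\<^sub>R d n + v *\<^sub>R d' n))"
    and "(\<Sum>n\<in>UNIV. cost N n (u *\<^sub>R g n + v *\<^sub>R g' n)) \<le>
      (\<Sum>n\<in>UNIV. u * cost N n (g n) + v * cost N n (g' n))"
    by (auto intro: sum_mono)
  then show ?thesis
    by (simp add: welfare_def sum.distrib algebra_simps flip: sum_distrib_left)
qed

lemma convex_attainable:
  assumes "grid_data N"
  shows "convex (attainable N)"
proof (rule convexI)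
  fix x y and u v :: real
  assume xy: "x \<in> attainable N" "y \<in> attainable N" and uv: "0 \<le> u" "0 \<le> v" "u + v = 1"
  obtain a b c t a' b' c' t' where x: "x = ((a, b, c), t)" and y: "y = ((a', b', c'), t')"
    by (metis prod.exhaust)
  from xy(1) obtain V p g d where 1:
    "V \<in> sparse_hermitian_mats N" "p \<in> dc_space N" "\<And>n. g n \<in> Gen N n" "\<And>n. d n \<in> Load N n"
    "\<And>n. a $ n = bus_power N n V p - (g n - d n)"
    "\<And>m. m \<in> con_set N \<Longrightarrow> con_mat N m \<bullet> V + con_vec N m \<bullet> p - con_bound N m \<le> b $ m"
    "\<And>k x. c $ k \<bullet> outer x \<le> Xi N k V \<bullet> outer x" "t \<le> welfare N g d"
    unfolding attainable_def x by blast
  from xy(2) obtain V' p' g' d' where 2: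
    "V' \<in> sparse_hermitian_mats N" "p' \<in> dc_space N" "\<And>n. g' n \<in> Gen N n" "\<And>n. d' n \<in> Load N n"
    "\<And>n. a' $ n = bus_power N n V' p' - (g' n - d' n)"
    "\<And>m. m \<in> con_set N \<Longrightarrow> con_mat N m \<bullet> V' + con_vec N m \<bullet> p' - con_bound N m \<le> b' $ m"
    "\<And>k x. c' $ k \<bullet> outer x \<le> Xi N k V' \<bullet> outer x" "t' \<le> welfare N g' d'"
    unfolding attainable_def y by blast
  let ?V = "u *\<^sub>R V + v *\<^sub>R V'" and ?p = "u *\<^sub>R p + v *\<^sub>R p'"
    and ?g = "\<lambda>n. u *\<^sub>R g n + v *\<^sub>R g' n" and ?d = "\<lambda>n. u *\<^sub>R d n + v *\<^sub>R d' n"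
  have "?V \<in> sparse_hermitian_mats N" "?p \<in> dc_space N"
    using 1 2 by (auto intro!: subspace_add subspace_scale subspace_sparse_hermitian_mats subspace_dc_space)
  moreover have "?g n \<in> Gen N n" "?d n \<in> Load N n" for n
    using assms 1 2 uv by (auto simp: grid_data_def intro: convexD)
  moreover have "(u *\<^sub>R a + v *\<^sub>R a') $ n = bus_power N n ?V ?p - (?g n - ?d n)" for n
    by (simp add: 1 2 bus_power_add bus_power_scaleR scaleR_diff_right)
  moreover have "con_mat N m \<bullet> ?V + con_vec N m \<bullet> ?p - con_bound N m \<le> (u *\<^sub>R b + v *\<^sub>R b') $ m"
    if m: "m \<in> con_set N" for m
  proof -
    \<comment> \<open>Giving the constant bound the weight \<open>u + v = 1\<close> lets the affine
      constraint split into the two given ones.\<close>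
    have "con_mat N m \<bullet> ?V + con_vec N m \<bullet> ?p - (u + v) * con_bound N m =
        u * (con_mat N m \<bullet> V + con_vec N m \<bullet> p - con_bound N m) +
        v * (con_mat N m \<bullet> V' + con_vec N m \<bullet> p' - con_bound N m)"
      by (simp add: inner_add_right algebra_simps)
    also have "\<dots> \<le> u * b $ m + v * b' $ m"
      using 1(6)[OF m] 2(6)[OF m] uv by (intro add_mono mult_left_mono)
    finally show ?thesis
      using uv by simp
  qed
  moreover have "(u *\<^sub>R c + v *\<^sub>R c') $ k \<bullet> outer x \<le> Xi N k ?V \<bullet> outer x" for k x
    using 1(7)[of k x] 2(7)[of k x] uv
    by (simp add: linear_add[OF linear_Xi] linear_scale[OF linear_Xi] inner_add_left add_mono mult_left_mono)
  moreover have "u * t + v * t' \<le> welfare N ?g ?d"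
  proof -
    have "u * t + v * t' \<le> u * welfare N g d + v * welfare N g' d'"
      using 1 2 uv by (intro add_mono mult_left_mono)
    also have "\<dots> \<le> welfare N ?g ?d"
      using assms 1 2 uv by (intro welfare_mixture)
    finally show ?thesis .
  qed
  ultimately have "((u *\<^sub>R a + v *\<^sub>R a', u *\<^sub>R b + v *\<^sub>R b', u *\<^sub>R c + v *\<^sub>R c'), u * t + v * t') \<in> attainable N"
    by (rule attainableI)
  then show "u *\<^sub>R x + v *\<^sub>R y \<in> attainable N"
    by (simp add: x y)
qed

text \<open>
  A strictly feasible \<open>v\<close> only gives singular matrices \<open>Xi N k (outer v)\<close>; adding a small multiple of
  the identity makes them positive definite, and the change of the bus powers is absorbed by the
  interior condition on generation minus load.
\<close>
lemma attainable_slater: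
  assumes "grid_data N" and "strict_feasibility N"
  shows "\<exists>\<eta>>0. \<exists>t. (\<eta> *\<^sub>R z, t) \<in> attainable N"
proof -
  obtain \<alpha> \<beta> \<gamma> where z: "z = (\<alpha>, \<beta>, \<gamma>)"
    by (metis prod.exhaust)
  obtain v p g d where feas: "opf_feasible N v p g d"
    and strict: "\<And>m. m \<in> con_set N \<Longrightarrow> con_value N (outer v) p m < con_bound N m"
    and int: "\<And>n. g n - d n \<in> interior {x - y |x y. x \<in> Gen N n \<and> y \<in> Load N n}"
    using assms(2) unfolding strict_feasibility_def by blast
  \<comment> \<open>Chosen so that \<open>s\<close> times the norm of each \<gamma>_k is at most 1;
    the form of \<epsilon> s \<gamma>_k then stays below that of \<epsilon> times the
    identity.\<close>
  define s where "s = inverse (1 + norm \<gamma>)"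
  have "s > 0"
    by (simp add: s_def add_pos_nonneg)
  define V where "V \<epsilon> = sparse_part N (outer v) + \<epsilon> *\<^sub>R mat 1" for \<epsilon> :: real
  have V0: "V 0 = sparse_part N (outer v)" and V: "V \<epsilon> = V 0 + \<epsilon> *\<^sub>R mat 1" for \<epsilon>
    by (simp_all add: V_def)
  have V_sparse: "V \<epsilon> \<in> sparse_hermitian_mats N" for \<epsilon>
    unfolding V_def
    by (intro subspace_add subspace_scale subspace_sparse_hermitian_mats sparse_part_sparse_hermitian
        outer_hermitian mat_1_sparse_hermitian assms)
  have soc: "soc_feasible N (V 0) p g d"
    unfolding V0 using soc_feasible_of_opf_feasible[OF assms(1) feas] .
  then have flow: "flow_constraints N (V 0) p g d" and psd: "\<And>k. psd (Xi N k (V 0))"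
    by (auto simp: soc_feasible_def)
  have p: "p \<in> dc_space N" and bal: "\<And>n. bus_power N n (V 0) p = g n - d n"
    using flow by (auto simp: flow_constraints_iff[OF sparse_hermitian_subset[OF V_sparse]])
  have con0: "con_mat N m \<bullet> V 0 + con_vec N m \<bullet> p < con_bound N m" if "m \<in> con_set N" for m
  proof -
    have "con_mat N m \<bullet> V 0 = con_mat N m \<bullet> outer v"
      unfolding V0 by (rule inner_cong_sparsity[OF con_mat_sparse_hermitian[OF assms(1)] sparse_part_nth])
    with strict[OF that] show ?thesis
      by (simp add: con_value_def tr_prod_eq_inner outer_hermitian)
  qed
  \<comment> \<open>The net injection that makes the balance residual at \<open>V \<epsilon>\<close>
    exactly \<epsilon> s \<alpha>_n.\<close>
  define R where "R \<epsilon> n = g n - d n + \<epsilon> *\<^sub>R (bus_power N n (mat 1) 0 - s *\<^sub>R \<alpha> $ n)" for \<epsilon> n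
  have R: "bus_power N n (V \<epsilon>) p - R \<epsilon> n = (\<epsilon> * s) *\<^sub>R \<alpha> $ n" for \<epsilon> n
  proof -
    have "bus_power N n (V \<epsilon>) p = bus_power N n (V 0) p + \<epsilon> *\<^sub>R bus_power N n (mat 1) 0"
      using bus_power_add[of N n "V 0" "\<epsilon> *\<^sub>R mat 1" p "\<epsilon> *\<^sub>R 0"]
      by (simp add: V[symmetric] bus_power_scaleR[of N n \<epsilon> "mat 1" 0, simplified])
    then show ?thesis
      by (simp add: R_def bal algebra_simps)
  qed
  have "\<forall>\<^sub>F \<epsilon> in at_right 0. R \<epsilon> n \<in> interior {x - y |x y. x \<in> Gen N n \<and> y \<in> Load N n}" for n
  proof (rule topological_tendstoD)
    show "((\<lambda>\<epsilon>. R \<epsilon> n) \<longlongrightarrow> g n - d n) (at_right 0)"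
      unfolding R_def by (rule tendsto_eq_intros | simp)+
  qed (use int in auto)
  moreover have "\<forall>\<^sub>F \<epsilon> in at_right 0.
      con_mat N m \<bullet> V \<epsilon> + con_vec N m \<bullet> p - (\<epsilon> * s) * \<beta> $ m < con_bound N m"
    if "m \<in> con_set N" for m
  proof (rule order_tendstoD)
    show "((\<lambda>\<epsilon>. con_mat N m \<bullet> V \<epsilon> + con_vec N m \<bullet> p - (\<epsilon> * s) * \<beta> $ m)
        \<longlongrightarrow> con_mat N m \<bullet> V 0 + con_vec N m \<bullet> p) (at_right 0)"
      unfolding V_def by (rule tendsto_eq_intros | simp)+
  qed (rule con0[OF that])
  moreover have "\<forall>\<^sub>F \<epsilon> in at_right 0. \<epsilon> > (0::real)"
    by (simp add: eventually_at_right_less)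
  \<comment> \<open>Finitely many conditions, each open and true in the limit, so one small positive
    \<epsilon> serves for all.\<close>
  ultimately have "\<forall>\<^sub>F \<epsilon> in at_right 0.
      (\<forall>n. R \<epsilon> n \<in> interior {x - y |x y. x \<in> Gen N n \<and> y \<in> Load N n}) \<and>
      (\<forall>m\<in>con_set N. con_mat N m \<bullet> V \<epsilon> + con_vec N m \<bullet> p - (\<epsilon> * s) * \<beta> $ m < con_bound N m) \<and> \<epsilon> > 0"
    by (intro eventually_conj eventually_all_finite eventually_ball_finite) auto
  then obtain \<epsilon> where "\<epsilon> > 0"
    and R_int: "\<And>n. R \<epsilon> n \<in> interior {x - y |x y. x \<in> Gen N n \<and> y \<in> Load N n}"
    and con: "\<And>m. m \<in> con_set N \<Longrightarrow>
      con_mat N m \<bullet> V \<epsilon> + con_vec N m \<bullet> p - (\<epsilon> * s) * \<beta> $ m < con_bound N m"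
    using eventually_happens'[OF trivial_limit_at_right_real] by blast
  have "\<exists>x y. R \<epsilon> n = x - y \<and> x \<in> Gen N n \<and> y \<in> Load N n" for n
    using R_int[of n] interior_subset by fast
  then obtain g' d' where g': "\<And>n. g' n \<in> Gen N n" and d': "\<And>n. d' n \<in> Load N n"
    and Rn: "\<And>n. R \<epsilon> n = g' n - d' n"
    by metis
  have "((\<epsilon> * s) *\<^sub>R \<gamma>) $ k \<bullet> outer x \<le> Xi N k (V \<epsilon>) \<bullet> outer x" for k x
  proof -
    have "\<gamma> $ k \<bullet> outer x \<le> norm (\<gamma> $ k) * norm (outer x)"
      by (rule norm_cauchy_schwarz)
    also have "\<dots> \<le> (1 + norm \<gamma>) * norm (outer x)"
      using Finite_Cartesian_Product.norm_nth_le[of \<gamma> k] by (intro mult_right_mono) auto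
    finally have "s * (\<gamma> $ k \<bullet> outer x) \<le> norm (outer x)"
      using \<open>s > 0\<close> unfolding s_def by (simp add: divide_simps add_pos_nonneg mult.commute)
    then have "\<epsilon> * (s * (\<gamma> $ k \<bullet> outer x)) \<le> \<epsilon> * norm (outer x)"
      using \<open>\<epsilon> > 0\<close> by simp
    moreover have "0 \<le> Xi N k (V 0) \<bullet> outer x"
      using psd by (simp add: psd_iff)
    moreover have "Xi N k (V \<epsilon>) = Xi N k (V 0) + \<epsilon> *\<^sub>R mat 1"
      using assms(1)
      by (simp add: V[of \<epsilon>] linear_add[OF linear_Xi] linear_scale[OF linear_Xi] Xi_mat_1 grid_data_def)
    ultimately show ?thesis
      by (simp add: inner_add_left inner_mat_1_outer norm_outer)
  qed
  moreover have "con_mat N m \<bullet> V \<epsilon> + con_vec N m \<bullet> p - con_bound N m \<le> ((\<epsilon> * s) *\<^sub>R \<beta>) $ m"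
    if "m \<in> con_set N" for m
    using con[OF that] by simp
  moreover have "((\<epsilon> * s) *\<^sub>R \<alpha>) $ n = bus_power N n (V \<epsilon>) p - (g' n - d' n)" for n
    using R[of n \<epsilon>] Rn[of n] by simp
  ultimately have "(((\<epsilon> * s) *\<^sub>R \<alpha>, (\<epsilon> * s) *\<^sub>R \<beta>, (\<epsilon> * s) *\<^sub>R \<gamma>), welfare N g' d') \<in> attainable N"
    using attainableI[OF V_sparse[of \<epsilon>] p g' d'] by blast
  then have "((\<epsilon> * s) *\<^sub>R z, welfare N g' d') \<in> attainable N"
    by (simp add: z)
  then show ?thesis
    using \<open>\<epsilon> > 0\<close> \<open>s > 0\<close> by (metis mult_pos_pos)
qed

text \<open>Apply the multiplier theorem to \<open>attainable N\<close> and read off dual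
  feasibility by varying each primal variable and slack separately. The boundedness conclusions
  record that the surpluses at this multiplier are true suprema.\<close>

lemma soc_strong_duality:
  fixes N :: "('v::finite, 'e::finite, 'd::finite) grid"
  assumes grid: "grid_data N" and "strict_feasibility N" and opt: "soc_optimal N V\<^sub>0 p\<^sub>0 g\<^sub>0 d\<^sub>0"
  obtains lam mu Lam where "soc_dual_feasible N lam mu Lam"
    and "dual_objective N lam mu \<le> welfare N g\<^sub>0 d\<^sub>0"
    and "\<forall>n. bdd_above ((\<lambda>d. benefit N n d - lam n \<bullet> d) ` Load N n)"
    and "\<forall>n. bdd_above ((\<lambda>g. lam n \<bullet> g - cost N n g) ` Gen N n)"
proof -
  let ?r = "welfare N g\<^sub>0 d\<^sub>0"
  have "t \<le> ?r" if 0: "(0, t) \<in> attainable N" for t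
  proof -
    have "((0, 0, 0), t) \<in> attainable N"
      using 0 by (simp add: zero_prod_def)
    then obtain V p g d where V: "V \<in> sparse_hermitian_mats N"
      and p: "p \<in> dc_space N" and g: "\<forall>n. g n \<in> Gen N n" and d: "\<forall>n. d n \<in> Load N n"
      and bal: "\<forall>n. 0 = bus_power N n V p - (g n - d n)"
      and con: "\<forall>m\<in>con_set N. con_mat N m \<bullet> V + con_vec N m \<bullet> p - con_bound N m \<le> 0"
      and psd: "\<forall>k x. 0 \<le> Xi N k V \<bullet> outer x" and t: "t \<le> welfare N g d"
      unfolding attainable_def by auto
    \<comment> \<open>At zero perturbation \<open>attainable\<close> gives only nonnegative forms;
      psd also needs Hermitian blocks, inherited from \<open>V\<close>.\<close>
    have "Xi N k V \<in> hermitian_mats" for k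
      using sparse_hermitian_subset[OF V] by (simp add: hermitian_mats_iff Xi_nth)
    then have "soc_feasible N V p g d"
      using V p g d bal con psd
      by (simp add: soc_feasible_def flow_constraints_iff sparse_hermitian_subset psd_iff)
    then have "welfare N g d \<le> ?r"
      using opt by (simp add: soc_optimal_def)
    with t show ?thesis by simp
  qed
  then obtain y where y: "\<And>z t. (z, t) \<in> attainable N \<Longrightarrow> t + y \<bullet> z \<le> ?r"
    using lagrange_multiplier_exists[OF convex_attainable[OF grid] _ attainable_slater[OF assms(1,2)]]
    by blast
  obtain \<alpha> \<beta> \<gamma> where y_eq: "y = (\<alpha>, \<beta>, \<gamma>)"
    by (metis prod.exhaust)
  \<comment> \<open>Signs follow the perturbations: a larger \<open>b\<close> relaxes (IN), whereas
    a larger \<open>c\<close> tightens the cone constraint, so only \<open>Lam\<close> keeps its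
    sign.\<close>
  define lam where "lam n = - (\<alpha> $ n)" for n
  define mu where "mu m = - (\<beta> $ m)" for m
  define Lam where "Lam k = \<gamma> $ k" for k
  define S where "S = (\<Sum>k\<in>UNIV. lift_mat N k (Lam k))"
  define F where "F g d = (\<Sum>n\<in>UNIV. benefit N n (d n) - lam n \<bullet> d n) +
      (\<Sum>n\<in>UNIV. lam n \<bullet> g n - cost N n (g n)) + (\<Sum>m\<in>con_set N. mu m * con_bound N m)" for g d
  \<comment> \<open>The Lagrangian bound with slacks \<open>b\<close> and \<open>c\<close> left
    free; \<open>F\<close> collects the terms that do not involve \<open>V\<close>, \<open>p\<close>
    or slacks.\<close>
  have lagr: "F g d + (S - Psi N lam mu) \<bullet> V - psi N lam mu \<bullet> p
      + (\<Sum>k\<in>UNIV. Lam k \<bullet> c k) - (\<Sum>m\<in>con_set N. mu m * b m) \<le> ?r"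
    if V: "V \<in> sparse_hermitian_mats N" and p: "p \<in> dc_space N"
      and g: "\<And>n. g n \<in> Gen N n" and d: "\<And>n. d n \<in> Load N n"
      and b: "\<And>m. b m \<ge> 0" and c: "\<And>k x. c k \<bullet> outer x \<le> 0" for V p g d b c
  proof -
    define A where "A = (\<chi> n. bus_power N n V p - (g n - d n))"
    \<comment> \<open>The type \<open>con\<close> also contains indices of absent DC branches; a
      zero there removes their multipliers from the sum.\<close>
    define B where "B = (\<chi> m. if m \<in> con_set N
        then con_mat N m \<bullet> V + con_vec N m \<bullet> p - con_bound N m + b m else 0)"
    define C where "C = (\<chi> k. Xi N k V + c k)"
    have "((A, B, C), welfare N g d) \<in> attainable N"
      using b c by (intro attainableI[OF V p, where g = g and d = d])
        (auto simp: A_def B_def C_def g d inner_add_left)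
    from y[OF this] have le: "welfare N g d + (\<alpha> \<bullet> A + \<beta> \<bullet> B + \<gamma> \<bullet> C) \<le> ?r"
      by (simp add: y_eq add.assoc)
    have A: "\<alpha> \<bullet> A = (\<Sum>n\<in>UNIV. lam n \<bullet> g n) - (\<Sum>n\<in>UNIV. lam n \<bullet> d n)
        - (\<Sum>n\<in>UNIV. lam n \<bullet> bus_power N n V p)"
      unfolding inner_vec_def[of \<alpha>] A_def lam_def
      by (simp add: inner_diff_right sum_subtractf sum_negf)
    have "\<beta> \<bullet> B = (\<Sum>m\<in>UNIV. if m \<in> con_set N
        then - (mu m * (con_mat N m \<bullet> V + con_vec N m \<bullet> p - con_bound N m + b m)) else 0)"
      unfolding inner_vec_def[of \<beta>] B_def mu_def by (intro sum.cong) auto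
    also have "\<dots> = (\<Sum>m\<in>con_set N. - (mu m * (con_mat N m \<bullet> V + con_vec N m \<bullet> p - con_bound N m + b m)))"
      by (simp add: sum.If_cases)
    also have "\<dots> = (\<Sum>m\<in>con_set N. mu m * con_bound N m) - (\<Sum>m\<in>con_set N. mu m * b m)
        - (\<Sum>m\<in>con_set N. mu m * (con_mat N m \<bullet> V + con_vec N m \<bullet> p))"
      by (simp add: algebra_simps sum.distrib sum_subtractf sum_negf)
    finally have B: "\<beta> \<bullet> B = \<dots>" .
    have C: "\<gamma> \<bullet> C = S \<bullet> V + (\<Sum>k\<in>UNIV. Lam k \<bullet> c k)"
      unfolding inner_vec_def[of \<gamma>] C_def S_def Lam_def
      by (simp add: inner_add_right sum.distrib inner_sum_left inner_lift_mat)
    have W: "F g d = welfare N g d + (\<Sum>n\<in>UNIV. lam n \<bullet> g n) - (\<Sum>n\<in>UNIV. lam n \<bullet> d n)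
        + (\<Sum>m\<in>con_set N. mu m * con_bound N m)"
      by (simp add: F_def welfare_def sum_subtractf)
    show ?thesis
      using le lagrangian_linear_part[of lam N V p mu] unfolding A B C W inner_diff_left by linarith
  qed
  have sub0: "0 \<in> sparse_hermitian_mats N" "0 \<in> dc_space N"
    by (simp_all add: subspace_0 subspace_sparse_hermitian_mats subspace_dc_space)
  have g\<^sub>0: "\<And>n. g\<^sub>0 n \<in> Gen N n" and d\<^sub>0: "\<And>n. d\<^sub>0 n \<in> Load N n"
    using opt by (auto simp: soc_optimal_def soc_feasible_def flow_constraints_def)
  have mu: "0 \<le> mu m" if m: "m \<in> con_set N" for m
  proof -
    \<comment> \<open>Let the slack of constraint \<open>m\<close> alone grow.\<close>
    have "- mu m \<le> 0"
    proof (rule le_affine_imp_slope_le_0)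
      fix s :: real assume s: "s \<ge> 0"
      have "(\<Sum>i\<in>con_set N. mu i * (if i = m then s else 0)) = s * mu m"
        using m by (simp add: if_distrib card_con_set cong: if_cong)
      with lagr[OF sub0 g\<^sub>0 d\<^sub>0, of "\<lambda>i. if i = m then s else 0" "\<lambda>k. 0"] s
      show "F g\<^sub>0 d\<^sub>0 + s * - mu m \<le> ?r" by simp
    qed
    then show ?thesis by simp
  qed
  have Lam_le: "Lam k \<bullet> Z \<le> 0" if Z: "\<And>x. Z \<bullet> outer x \<le> 0" for k Z
  proof (rule le_affine_imp_slope_le_0)
    fix s :: real assume s: "s \<ge> 0"
    have "(\<Sum>i\<in>UNIV. Lam i \<bullet> (if i = k then s *\<^sub>R Z else 0)) = s * (Lam k \<bullet> Z)"
      by (simp add: if_distrib cong: if_cong)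
    with lagr[OF sub0 g\<^sub>0 d\<^sub>0, of "\<lambda>i. 0" "\<lambda>i. if i = k then s *\<^sub>R Z else 0"] s Z
    show "F g\<^sub>0 d\<^sub>0 + s * (Lam k \<bullet> Z) \<le> ?r"
      by (simp add: mult_nonneg_nonpos)
  qed
  have psd: "psd (Lam k)" for k
    unfolding psd_iff
  proof (intro conjI allI)
    \<comment> \<open>A matrix with vanishing forms is admissible in \<open>Lam_le\<close>, which is
      the test that \<open>hermitian_of_orthogonal\<close> asks for.\<close>
    show "Lam k \<in> hermitian_mats"
      by (rule hermitian_of_orthogonal) (simp add: Lam_le)
    show "0 \<le> Lam k \<bullet> outer x" for x
      using Lam_le[of "- outer x" k] psd_outer[of x] by (simp add: psd_iff)
  qed
  have lagr0: "F g d + (S - Psi N lam mu) \<bullet> V - psi N lam mu \<bullet> p \<le> ?r"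
    if "V \<in> sparse_hermitian_mats N" "p \<in> dc_space N"
      "\<And>n. g n \<in> Gen N n" "\<And>n. d n \<in> Load N n" for V p g d
    using lagr[OF that, of "\<lambda>i. 0" "\<lambda>k. 0"] by simp
  \<comment> \<open>\<open>V\<close> varies only over sparse Hermitian matrices, so the residual
    \<open>S - Psi N lam mu\<close> must lie in that space to serve as its own test
    direction.\<close>
  have "S \<in> sparse_hermitian_mats N"
    unfolding S_def using psd
    by (intro subspace_sum subspace_sparse_hermitian_mats lift_mat_sparse_hermitian) (simp add: psd_iff)
  then have D: "S - Psi N lam mu \<in> sparse_hermitian_mats N"
    using Psi_sparse_hermitian[OF grid] subspace_diff[OF subspace_sparse_hermitian_mats] by blast
  have "(S - Psi N lam mu) \<bullet> (S - Psi N lam mu) \<le> 0"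
  proof (rule le_affine_imp_slope_le_0)
    fix s :: real
    show "F g\<^sub>0 d\<^sub>0 + s * ((S - Psi N lam mu) \<bullet> (S - Psi N lam mu)) \<le> ?r"
      using lagr0[OF subspace_scale[OF subspace_sparse_hermitian_mats D, of s] sub0(2) g\<^sub>0 d\<^sub>0] by simp
  qed
  then have Psi: "Psi N lam mu = S"
    by (metis eq_iff_diff_eq_0 inner_gt_zero_iff not_less)
  \<comment> \<open>The test direction for \<open>p\<close> is \<open>- psi N lam mu\<close>, which
    lies in the DC space.\<close>
  have "psi N lam mu \<bullet> psi N lam mu \<le> 0"
  proof (rule le_affine_imp_slope_le_0)
    fix s :: real
    show "F g\<^sub>0 d\<^sub>0 + s * (psi N lam mu \<bullet> psi N lam mu) \<le> ?r"
      using lagr0[OF sub0(1) subspace_scale[OF subspace_dc_space psi_in_dc_space[OF grid], of "- s"] g\<^sub>0 d\<^sub>0]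
      by simp
  qed
  then have psi: "psi N lam mu = 0"
    by (metis inner_gt_zero_iff not_less)
  have F: "F g d \<le> ?r" if "\<And>n. g n \<in> Gen N n" "\<And>n. d n \<in> Load N n" for g d
    using lagr0[OF sub0 that] by simp
  have ne: "\<And>n. Gen N n \<noteq> {}" "\<And>n. Load N n \<noteq> {}"
    using grid by (auto simp: grid_data_def)
  let ?b = "\<Sum>m\<in>con_set N. mu m * con_bound N m"
  \<comment> \<open>The two suprema are taken in turn: over the loads with generation fixed, then
    over generation.\<close>
  have load: "(\<Sum>n\<in>UNIV. benefit N n (d n) - lam n \<bullet> d n) \<le>
      ?r - ?b - (\<Sum>n\<in>UNIV. lam n \<bullet> g n - cost N n (g n))"
    if "\<And>n. g n \<in> Gen N n" "\<And>n. d n \<in> Load N n" for g d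
    using F[OF that] by (simp add: F_def)
  have surplus: "(\<Sum>n\<in>UNIV. load_surplus N n (lam n)) \<le>
      ?r - ?b - (\<Sum>n\<in>UNIV. lam n \<bullet> g n - cost N n (g n))" if "\<And>n. g n \<in> Gen N n" for g
    unfolding load_surplus_def
    by (rule sum_SUP_le[OF _ ne(2) load[OF that]]) auto
  show thesis
  proof
    show "soc_dual_feasible N lam mu Lam"
      using mu psd psi Psi by (simp add: soc_dual_feasible_def S_def lift_mat_def)
    have "(\<Sum>n\<in>UNIV. gen_surplus N n (lam n)) \<le> ?r - ?b - (\<Sum>n\<in>UNIV. load_surplus N n (lam n))"
      unfolding gen_surplus_def
    proof (rule sum_SUP_le[OF _ ne(1)])
      fix g assume "\<And>n. g n \<in> Gen N n"
      from surplus[OF this]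
      show "(\<Sum>n\<in>UNIV. lam n \<bullet> g n - cost N n (g n)) \<le> ?r - ?b - (\<Sum>n\<in>UNIV. load_surplus N n (lam n))"
        by linarith
    qed simp
    then show "dual_objective N lam mu \<le> ?r"
      by (simp add: dual_objective_def)
    show "\<forall>n. bdd_above ((\<lambda>d. benefit N n d - lam n \<bullet> d) ` Load N n)"
      by (rule allI, rule bdd_above_of_sum_le[OF finite UNIV_I ne(2) load[OF g\<^sub>0]])
    show "\<forall>n. bdd_above ((\<lambda>g. lam n \<bullet> g - cost N n g) ` Gen N n)"
    proof (rule allI, rule bdd_above_of_sum_le[OF finite UNIV_I ne(1)])
      fix g assume "\<And>n. g n \<in> Gen N n"
      from load[OF this d\<^sub>0]
      show "(\<Sum>n\<in>UNIV. lam n \<bullet> g n - cost N n (g n)) \<le>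
          ?r - ?b - (\<Sum>n\<in>UNIV. benefit N n (d\<^sub>0 n) - lam n \<bullet> d\<^sub>0 n)"
        by linarith
    qed
  qed
qed

section \<open>Weak duality for OPF and transfer of optimality\<close>

text \<open>Changing the price adds a linear function, bounded on a compact set; boundedness at one
  price thus spreads to all prices.\<close>

lemma bdd_above_add_linear:
  fixes f :: "'a::real_inner \<Rightarrow> real"
  assumes "compact S" and "bdd_above ((\<lambda>x. f x + l \<bullet> x) ` S)"
  shows "bdd_above ((\<lambda>x. f x + l' \<bullet> x) ` S)"
proof -
  have "compact ((\<lambda>x. (l' - l) \<bullet> x) ` S)"
    using assms(1) by (intro compact_continuous_image continuous_intros)
  then have "bdd_above ((\<lambda>x. (l' - l) \<bullet> x) ` S)"
    by (intro bounded_imp_bdd_above compact_imp_bounded)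
  then obtain c c' where "\<And>x. x \<in> S \<Longrightarrow> f x + l \<bullet> x \<le> c" "\<And>x. x \<in> S \<Longrightarrow> (l' - l) \<bullet> x \<le> c'"
    using assms(2) unfolding bdd_above_def by blast
  then have "f x + l' \<bullet> x \<le> c + c'" if "x \<in> S" for x
    using that by (fastforce simp: inner_diff_left)
  then show ?thesis
    by (rule bdd_aboveI2)
qed

text \<open>Each term of the Lagrangian at the feasible point is compared with its dual counterpart.
  Boundedness is assumed because a real \<open>SUP\<close> dominates its members only for sets
  bounded above.\<close>

lemma opf_weak_duality:
  assumes feas: "opf_feasible N v p g d" and dual: "opf_dual_feasible N lam mu"
    and bdd_load: "\<And>n. bdd_above ((\<lambda>d. benefit N n d - lam n \<bullet> d) ` Load N n)"
    and bdd_gen: "\<And>n. bdd_above ((\<lambda>g. lam n \<bullet> g - cost N n g) ` Gen N n)"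
  shows "welfare N g d \<le> dual_objective N lam mu"
proof -
  let ?W = "outer v"
  have g: "\<And>n. g n \<in> Gen N n" and d: "\<And>n. d n \<in> Load N n"
    and bal: "\<And>n. bus_power N n ?W p = g n - d n"
    and con: "\<And>m. m \<in> con_set N \<Longrightarrow> con_mat N m \<bullet> ?W + con_vec N m \<bullet> p \<le> con_bound N m"
    using feas by (auto simp: opf_feasible_def flow_constraints_iff outer_hermitian)
  have mu: "\<And>m. m \<in> con_set N \<Longrightarrow> 0 \<le> mu m" and psi: "psi N lam mu = 0"
    and Psi: "0 \<le> Psi N lam mu \<bullet> ?W"
    using dual by (auto simp: opf_dual_feasible_def psd_iff)
  have "(\<Sum>n\<in>UNIV. benefit N n (d n) - lam n \<bullet> d n) \<le> (\<Sum>n\<in>UNIV. load_surplus N n (lam n))"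
    unfolding load_surplus_def using d bdd_load by (intro sum_mono cSUP_upper)
  moreover have "(\<Sum>n\<in>UNIV. lam n \<bullet> g n - cost N n (g n)) \<le> (\<Sum>n\<in>UNIV. gen_surplus N n (lam n))"
    unfolding gen_surplus_def using g bdd_gen by (intro sum_mono cSUP_upper)
  moreover have "(\<Sum>m\<in>con_set N. mu m * (con_mat N m \<bullet> ?W + con_vec N m \<bullet> p)) \<le>
      (\<Sum>m\<in>con_set N. mu m * con_bound N m)"
    using con mu by (intro sum_mono mult_left_mono)
  \<comment> \<open>With \<open>psi\<close> zero the linear part is the form of the psd matrix
    \<open>Psi\<close> at \<open>v\<close>.\<close>
  moreover have "(\<Sum>n\<in>UNIV. lam n \<bullet> (g n - d n)) +
      (\<Sum>m\<in>con_set N. mu m * (con_mat N m \<bullet> ?W + con_vec N m \<bullet> p)) \<ge> 0"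
    using lagrangian_linear_part[of lam N ?W p mu] Psi by (simp add: psi bal)
  ultimately show ?thesis
    by (simp add: dual_objective_def welfare_def sum_subtractf inner_diff_right)
qed

theorem theorem4:
  fixes N :: "('v::finite, 'e::finite, 'd::finite) grid"
    and V :: "complex^'v^'v" and p :: "real^'d" and g d :: "'v \<Rightarrow> real^2"
    and lam :: "'v \<Rightarrow> real^2" and mu :: "('v, 'e, 'd) con \<Rightarrow> real"
    and Lam :: "'e \<Rightarrow> complex^2^2"
  assumes "grid_data N"
    and "strict_feasibility N"
    and "soc_optimal N V p g d"
    and "soc_dual_optimal N lam mu Lam"
    and "\<exists>V'. psd_rank1_completion N V' V"
  shows "(\<exists>v. psd_rank1_completion N (outer v) V) \<and>
    (\<forall>v. psd_rank1_completion N (outer v) V \<longrightarrow>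
       opf_optimal N v p g d \<and> opf_dual_optimal N lam mu)"
proof (intro conjI allI impI)
  obtain V' where V': "psd_rank1_completion N V' V"
    using assms(5) by blast
  then obtain v where "V' = outer v"
    using psd_rank_1_eq_outer by (metis psd_rank1_completion_def)
  with V' show "\<exists>v. psd_rank1_completion N (outer v) V"
    by blast
next
  fix v assume "psd_rank1_completion N (outer v) V"
  then have eq: "outer v $ i $ j = V $ i $ j" if "(i, j) \<in> sparsity N" for i j
    using that by (auto simp: psd_rank1_completion_def)
  have soc: "soc_feasible N V p g d"
    using assms(3) by (simp add: soc_optimal_def)
  then have "V \<in> hermitian_mats"
    by (auto simp: soc_feasible_def intro: sparse_hermitian_subset)
  then have feas: "opf_feasible N v p g d"
    using flow_constraints_cong_sparsity[OF assms(1) outer_hermitian _ eq] soc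
    by (simp add: opf_feasible_def soc_feasible_def)
  show "opf_optimal N v p g d"
    unfolding opf_optimal_def
  proof (intro conjI allI impI)
    fix v' p' g' d' assume "opf_feasible N v' p' g' d'"
    from soc_feasible_of_opf_feasible[OF assms(1) this]
    show "welfare N g' d' \<le> welfare N g d"
      using assms(3) unfolding soc_optimal_def by blast
  qed (rule feas)
  obtain lam\<^sub>0 mu\<^sub>0 Lam\<^sub>0 where dual0: "soc_dual_feasible N lam\<^sub>0 mu\<^sub>0 Lam\<^sub>0"
    and obj0: "dual_objective N lam\<^sub>0 mu\<^sub>0 \<le> welfare N g d"
    and bdd0: "\<forall>n. bdd_above ((\<lambda>d. benefit N n d - lam\<^sub>0 n \<bullet> d) ` Load N n)"
      "\<forall>n. bdd_above ((\<lambda>g. lam\<^sub>0 n \<bullet> g - cost N n g) ` Gen N n)"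
    by (rule soc_strong_duality[OF assms(1-3)])
  \<comment> \<open>The given dual optimum is no worse than the constructed dual point, whose value
    is at most the welfare.\<close>
  have "dual_objective N lam mu \<le> welfare N g d"
    using assms(4) dual0 obj0 unfolding soc_dual_optimal_def by (meson order_trans)
  moreover have "welfare N g d \<le> dual_objective N lam' mu'" if "opf_dual_feasible N lam' mu'" for lam' mu'
  proof (rule opf_weak_duality[OF feas that])
    fix n
    \<comment> \<open>Boundedness is carried from \<open>lam\<^sub>0\<close> to \<open>lam'\<close>;
      on the load side the prices enter with a minus sign.\<close>
    have "compact (Load N n)" "compact (Gen N n)"
      using assms(1) by (auto simp: grid_data_def)
    then show "bdd_above ((\<lambda>d. benefit N n d - lam' n \<bullet> d) ` Load N n)"
      and "bdd_above ((\<lambda>g. lam' n \<bullet> g - cost N n g) ` Gen N n)"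
      using bdd_above_add_linear[of "Load N n" "benefit N n" "- lam\<^sub>0 n" "- lam' n"]
        bdd_above_add_linear[of "Gen N n" "\<lambda>g. - cost N n g" "lam\<^sub>0 n" "lam' n"] bdd0
      by simp_all
  qed
  moreover have "opf_dual_feasible N lam mu"
    using assms(4) psd_sum_lift_mat[of Lam N]
    by (simp add: soc_dual_optimal_def soc_dual_feasible_def opf_dual_feasible_def lift_mat_def)
  ultimately show "opf_dual_optimal N lam mu"
    unfolding opf_dual_optimal_def by (meson order_trans)
qed

end
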